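(* The class of (countably infinite) injective prefix trees is punctually robust: every computable injective prefix tree is isomorphic to a punctual injective prefix tree.
   Context: A prefix tree is a structure $\mathcal T=(T,R_1,R_2,R_3,\dots;r)$ in the infinite signature where each $R_n$ is an $n$-ary relation and $r\in T$, satisfying: (1) $R_1=\{r\}$; (2) if $R_n(a_1,\dots,a_n)$ and $1\le i\le n$ then $R_i(a_1,\dots,a_i)$. It is injective if whenever $R_{n+1}(a_1,\dots,a_n,c)$ and $R_{k+1}(b_1,\dots,b_k,c)$ then $n=k$ and $a_i=b_i$ for all $i\le n$. A structure with such an infinite signature is computable if its domain is a computable subset of $\mathbb N$ and the relations are uniformly computable (and the constant computable). It is punctual if its domain is $\mathbb N$, all relations and constants of the signature are uniformly primitive recursive, and the function assigning to the index of a relation its arity is primitive recursive. A class is punctually robust if every computable member is isomorphic to a punctual structure. *)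

theory Defs
  imports Main "HOL-Library.Nat_Bijection"
begin

section \<open>Partial recursive and primitive recursive functions\<close>

text \<open>
  Terms carry no arity: a term denotes a partial function on argument lists, and a function
  of arity \<open>n\<close> is obtained by restricting attention to lists of length \<open>n\<close>.
\<close>

datatype rec_term =
    Zero
  | Succ
  | Proj nat
  | Comp rec_term "rec_term list"
  | Prec rec_term rec_term
  | Mu rec_term

inductive evaluates :: "rec_term \<Rightarrow> nat list \<Rightarrow> nat \<Rightarrow> bool" where
  Zero: "evaluates Zero xs 0"
| Succ: "evaluates Succ [x] (Suc x)"
| Proj: "i < length xs \<Longrightarrow> evaluates (Proj i) xs (xs ! i)"
| Comp: "list_all2 (\<lambda>g y. evaluates g xs y) gs ys \<Longrightarrow> evaluates f ys z \<Longrightarrow>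
    evaluates (Comp f gs) xs z"
| Prec_0: "evaluates f xs y \<Longrightarrow> evaluates (Prec f g) (0 # xs) y"
| Prec_Suc: "evaluates (Prec f g) (n # xs) y \<Longrightarrow> evaluates g (n # y # xs) z \<Longrightarrow>
    evaluates (Prec f g) (Suc n # xs) z"
| Mu: "evaluates f (n # xs) 0 \<Longrightarrow> \<forall>m<n. \<exists>y. evaluates f (m # xs) (Suc y) \<Longrightarrow>
    evaluates (Mu f) xs n"

fun mu_free :: "rec_term \<Rightarrow> bool" where
  "mu_free Zero \<longleftrightarrow> True"
| "mu_free Succ \<longleftrightarrow> True"
| "mu_free (Proj i) \<longleftrightarrow> True"
| "mu_free (Comp f gs) \<longleftrightarrow> mu_free f \<and> (\<forall>g\<in>set gs. mu_free g)"
| "mu_free (Prec f g) \<longleftrightarrow> mu_free f \<and> mu_free g"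
| "mu_free (Mu f) \<longleftrightarrow> False"

definition computable_fun :: "nat \<Rightarrow> (nat list \<Rightarrow> nat) \<Rightarrow> bool" where
  "computable_fun n f \<longleftrightarrow> (\<exists>t. \<forall>xs. length xs = n \<longrightarrow> evaluates t xs (f xs))"

definition primrec_fun :: "nat \<Rightarrow> (nat list \<Rightarrow> nat) \<Rightarrow> bool" where
  "primrec_fun n f \<longleftrightarrow>
    (\<exists>t. mu_free t \<and> (\<forall>xs. length xs = n \<longrightarrow> evaluates t xs (f xs)))"

inductive_cases evaluates_elims:
  "evaluates Zero xs y"
  "evaluates Succ xs y"
  "evaluates (Proj i) xs y"
  "evaluates (Comp f gs) xs y"
  "evaluates (Prec f g) (0 # xs) y"
  "evaluates (Prec f g) (Suc n # xs) y"
  "evaluates (Mu f) xs y"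

lemma evaluates_deterministic:
  "evaluates t xs y \<Longrightarrow> evaluates t xs z \<Longrightarrow> y = z"
proof (induction arbitrary: z rule: evaluates.induct)
  case (Comp xs gs ys f w)
  from Comp.prems obtain ys' where
    ys': "list_all2 (\<lambda>g y. evaluates g xs y) gs ys'" "evaluates f ys' z"
    by (rule evaluates_elims(4))
  have "ys = ys'"
  proof (rule nth_equalityI)
    show "length ys = length ys'"
      using list_all2_lengthD[OF Comp.IH(1)] list_all2_lengthD[OF ys'(1)] by linarith
    show "ys ! i = ys' ! i" if "i < length ys" for i
    proof -
      have "evaluates (gs ! i) xs (ys' ! i)"
        by (rule list_all2_nthD2[OF ys'(1)]) (use that \<open>length ys = length ys'\<close> in simp)
      with list_all2_nthD2[OF Comp.IH(1) that] show ?thesis by blast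
    qed
  qed
  with Comp.IH(2) ys'(2) show ?case by blast
next
  case (Prec_Suc f g n xs y w)
  from Prec_Suc.prems obtain y' where
    "evaluates (Prec f g) (n # xs) y'" "evaluates g (n # y' # xs) z"
    by (rule evaluates_elims(6))
  with Prec_Suc.IH show ?case by blast
next
  case (Mu f n xs)
  from Mu.prems have z: "evaluates f (z # xs) 0"
      "\<forall>m<z. \<exists>y. evaluates f (m # xs) (Suc y)"
    by (blast elim: evaluates_elims(7))+
  have "\<not> z < n"
    using Mu.IH(2) z(1) by (metis nat.distinct(1))
  moreover have "\<not> n < z"
    using Mu.IH(1) z(2) by (metis nat.distinct(1))
  ultimately show ?case by simp
next
  case (Zero xs)
  then show ?case by (rule evaluates_elims(1)) simp
next
  case (Succ x)
  then show ?case by (rule evaluates_elims(2)) simp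
next
  case (Proj i xs)
  from Proj.prems show ?case by (rule evaluates_elims(3)) simp
next
  case (Prec_0 f xs y g)
  from Prec_0.prems have "evaluates f xs z" by (rule evaluates_elims(5))
  then show ?case by (rule Prec_0.IH)
qed


section \<open>Structures with infinitely many relations and one constant\<close>

record 'a rel_structure =
  universe :: "'a set"
  arity :: "nat \<Rightarrow> nat"
  relation :: "nat \<Rightarrow> 'a list set"
  distinguished :: 'a

definition wf_structure :: "'a rel_structure \<Rightarrow> bool" where
  "wf_structure A \<longleftrightarrow>
    distinguished A \<in> universe A \<and>
    (\<forall>i. relation A i \<subseteq> {xs \<in> lists (universe A). length xs = arity A i})"

definition isomorphic :: "'a rel_structure \<Rightarrow> 'b rel_structure \<Rightarrow> bool" (infix \<open>\<simeq>\<close> 50) where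
  "A \<simeq> B \<longleftrightarrow>
    arity A = arity B \<and>
    (\<exists>f. bij_betw f (universe A) (universe B) \<and>
      f (distinguished A) = distinguished B \<and>
      (\<forall>i. \<forall>xs \<in> lists (universe A). length xs = arity A i \<longrightarrow>
        (xs \<in> relation A i \<longleftrightarrow> map f xs \<in> relation B i)))"

text \<open>
  Uniformity in the index of the relation is expressed by the characteristic function of all
  pairs of an index \<open>i\<close> and a code of a tuple in the \<open>i\<close>-th relation.
\<close>

definition relations_char :: "nat rel_structure \<Rightarrow> nat list \<Rightarrow> nat" where
  "relations_char A = (\<lambda>xs. of_bool (list_decode (xs ! 1) \<in> relation A (xs ! 0)))"

definition computable_structure :: "nat rel_structure \<Rightarrow> bool" where
  "computable_structure A \<longleftrightarrow>
    wf_structure A \<and>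
    computable_fun 1 (\<lambda>xs. of_bool (xs ! 0 \<in> universe A)) \<and>
    computable_fun 2 (relations_char A) \<and>
    computable_fun 0 (\<lambda>_. distinguished A)"

definition punctual :: "nat rel_structure \<Rightarrow> bool" where
  "punctual A \<longleftrightarrow>
    wf_structure A \<and>
    universe A = UNIV \<and>
    primrec_fun 2 (relations_char A) \<and>
    primrec_fun 0 (\<lambda>_. distinguished A) \<and>
    primrec_fun 1 (\<lambda>xs. arity A (xs ! 0))"

definition punctually_robust :: "nat rel_structure set \<Rightarrow> bool" where
  "punctually_robust K \<longleftrightarrow>
    (\<forall>A\<in>K. computable_structure A \<longrightarrow> (\<exists>B. punctual B \<and> A \<simeq> B))"


section \<open>Prefix trees\<close>

text \<open>
  The relation with index \<open>n\<close> has arity \<open>n + 1\<close>: it is the relation \<open>R\<^sub>n\<^sub>+\<^sub>1\<close> of the sequence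
  \<open>R\<^sub>1, R\<^sub>2, R\<^sub>3, \<dots>\<close>.
\<close>

definition prefix_tree :: "'a rel_structure \<Rightarrow> bool" where
  "prefix_tree T \<longleftrightarrow>
    wf_structure T \<and>
    arity T = Suc \<and>
    relation T 0 = {[distinguished T]} \<and>
    (\<forall>n. \<forall>as \<in> relation T n. \<forall>i\<le>n. take (Suc i) as \<in> relation T i)"

definition injective_prefix_tree :: "'a rel_structure \<Rightarrow> bool" where
  "injective_prefix_tree T \<longleftrightarrow>
    prefix_tree T \<and>
    (\<forall>n k as bs c. as @ [c] \<in> relation T n \<and> bs @ [c] \<in> relation T k \<longrightarrow> n = k \<and> as = bs)"

definition injective_prefix_trees :: "nat rel_structure set" where
  "injective_prefix_trees = {T. injective_prefix_tree T \<and> infinite (universe T)}"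

end

theory Submission
  imports Defs "HOL-Library.Infinite_Set"
begin

text \<open>
  By injectivity, the relations are exactly the finite paths from the root \<open>r\<close> along the
  parent-child relation \<open>E\<close>, so it suffices to find a bijection from \<open>nat\<close> onto the universe under
  which \<open>E\<close> becomes primitive recursive. Only a primitive recursive enumeration of \<open>E\<close> by stages is
  available, and a tree node is placed at the first stage that enumerates the edge into it. The
  remaining stages need elements to stand for, without knowing what \<open>E\<close> will turn out to be.

  If there are infinitely many isolated elements (those outside the tree), these are used.
  Otherwise, if only finitely many nodes have children, some node has infinitely many leaves as
  children, and these are used.
  Otherwise infinitely many edges are \<^emph>\<open>records\<close>: both ends exceed all ends of earlier records.
  The targets of the records are used, in order. Since records increase, once the records have
  passed a number it is decided whether that number is a record source or target; placing a node only
  after that moment lets it know its record child.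
\<close>

subsection \<open>Primitive recursive functions\<close>

named_theorems pr_intros

section \<open>Substitution and primitive recursion\<close>

lemma primrec_fun_cong:
  assumes "primrec_fun n f" "\<And>xs. length xs = n \<Longrightarrow> f xs = g xs"
  shows "primrec_fun n g"
  using assms unfolding primrec_fun_def by fastforce

lemma primrec_fun_const [pr_intros]: "primrec_fun n (\<lambda>_. c)"
proof (induction c)
  case 0
  show ?case unfolding primrec_fun_def
    by (intro exI[of _ Zero]) (auto intro: evaluates.Zero)
next
  case (Suc c)
  then obtain t where t: "mu_free t" "\<And>xs. length xs = n \<Longrightarrow> evaluates t xs c"
    unfolding primrec_fun_def by blast
  show ?case unfolding primrec_fun_def
  proof (intro exI[of _ "Comp Succ [t]"] conjI allI impI)
    show "evaluates (Comp Succ [t]) xs (Suc c)" if "length xs = n" for xs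
      by (rule evaluates.Comp[where ys="[c]"]) (use t that in \<open>auto intro: evaluates.Succ\<close>)
  qed (use t in auto)
qed

lemma primrec_fun_nth [pr_intros]: "i < n \<Longrightarrow> primrec_fun n (\<lambda>xs. xs ! i)"
  unfolding primrec_fun_def by (intro exI[of _ "Proj i"]) (auto intro: evaluates.Proj)

text \<open>A whole argument list is treated as one object, so that substitution into a function of
  any arity is a single rule. Since terms carry no arity, the length is recorded here.\<close>

definition primrec_list :: "nat \<Rightarrow> nat \<Rightarrow> (nat list \<Rightarrow> nat list) \<Rightarrow> bool" where
  "primrec_list n m L \<longleftrightarrow>
    (\<forall>xs. length xs = n \<longrightarrow> length (L xs) = m) \<and> (\<forall>i<m. primrec_fun n (\<lambda>xs. L xs ! i))"

lemma primrec_fun_app: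
  assumes "primrec_fun m f" "primrec_list n m L"
  shows "primrec_fun n (\<lambda>xs. f (L xs))"
proof -
  from assms(1) obtain t where t: "mu_free t" "\<And>xs. length xs = m \<Longrightarrow> evaluates t xs (f xs)"
    unfolding primrec_fun_def by blast
  have "\<forall>i<m. \<exists>u. mu_free u \<and> (\<forall>xs. length xs = n \<longrightarrow> evaluates u xs (L xs ! i))"
    using assms(2) unfolding primrec_list_def primrec_fun_def by blast
  then obtain u where u: "\<And>i. i < m \<Longrightarrow> mu_free (u i)"
    "\<And>i xs. i < m \<Longrightarrow> length xs = n \<Longrightarrow> evaluates (u i) xs (L xs ! i)" by metis
  show ?thesis unfolding primrec_fun_def
  proof (intro exI[of _ "Comp t (map u [0..<m])"] conjI allI impI)
    show "mu_free (Comp t (map u [0..<m]))" using t u by auto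
    fix xs :: "nat list" assume xs: "length xs = n"
    then have len: "length (L xs) = m" using assms(2) unfolding primrec_list_def by blast
    show "evaluates (Comp t (map u [0..<m])) xs (f (L xs))"
      by (rule evaluates.Comp[where ys="L xs"])
        (use t u xs len in \<open>auto simp: list_all2_conv_all_nth\<close>)
  qed
qed

lemma primrec_list_id [pr_intros]: "primrec_list n n (\<lambda>xs. xs)"
  by (simp add: primrec_list_def primrec_fun_nth)

lemma primrec_list_tl [pr_intros]:
  assumes "primrec_list n (Suc m) L"
  shows "primrec_list n m (\<lambda>xs. tl (L xs))"
  unfolding primrec_list_def
proof (intro conjI allI impI)
  fix i assume i: "i < m"
  have "primrec_fun n (\<lambda>xs. L xs ! Suc i)" using assms i unfolding primrec_list_def by auto
  then show "primrec_fun n (\<lambda>xs. tl (L xs) ! i)"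
    by (rule primrec_fun_cong) (use assms i in \<open>auto simp: primrec_list_def nth_tl\<close>)
qed (use assms in \<open>auto simp: primrec_list_def\<close>)

lemma primrec_list_Nil [pr_intros]: "primrec_list n 0 (\<lambda>xs. [])"
  by (simp add: primrec_list_def)

lemma primrec_list_Cons [pr_intros]:
  assumes "primrec_fun n a" "primrec_list n m L"
  shows "primrec_list n (Suc m) (\<lambda>xs. a xs # L xs)"
  using assms by (auto simp: primrec_list_def nth_Cons' less_Suc_eq_0_disj)

text \<open>Recursions, sums and quantifiers push their bound variables onto the front of the
  argument list, so the original arguments turn up behind up to three \<open>tl\<close>.\<close>

lemma primrec_fun_nth_tl [pr_intros]:
  "Suc i < n \<Longrightarrow> primrec_fun n (\<lambda>xs. tl xs ! i)"
  "Suc (Suc i) < n \<Longrightarrow> primrec_fun n (\<lambda>xs. tl (tl xs) ! i)"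
  "Suc (Suc (Suc i)) < n \<Longrightarrow> primrec_fun n (\<lambda>xs. tl (tl (tl xs)) ! i)"
  by (rule primrec_fun_cong[OF primrec_fun_nth], assumption, simp add: nth_tl)+

lemma primrec_fun_1:
  assumes "primrec_fun 1 (\<lambda>xs. g (xs ! 0))" "primrec_fun n a"
  shows "primrec_fun n (\<lambda>xs. g (a xs))"
  using primrec_fun_app[OF assms(1), of n "\<lambda>xs. [a xs]"] assms(2)
  by (simp add: primrec_list_Cons primrec_list_Nil)

lemma primrec_fun_2:
  assumes "primrec_fun 2 (\<lambda>xs. g (xs ! 0) (xs ! 1))" "primrec_fun n a" "primrec_fun n b"
  shows "primrec_fun n (\<lambda>xs. g (a xs) (b xs))"
  using primrec_fun_app[OF assms(1), of n "\<lambda>xs. [a xs, b xs]"] assms(2,3)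
  by (simp add: primrec_list_Cons primrec_list_Nil numeral_2_eq_2)

text \<open>\<open>Prec\<close> recurses on its first argument: the counter is first treated as a
  new leading argument, and \<open>a\<close> is substituted for it afterwards. In the step,
  positions 0 and 1 hold the counter and the previous value.\<close>

lemma primrec_fun_rec_nat [pr_intros]:
  assumes "primrec_fun n b" "primrec_fun (Suc (Suc n)) (\<lambda>ys. g (ys ! 0) (ys ! 1) (tl (tl ys)))"
    "primrec_fun n a"
  shows "primrec_fun n (\<lambda>xs. rec_nat (b xs) (\<lambda>k y. g k y xs) (a xs))"
proof -
  from assms(1) obtain t where t: "mu_free t" "\<And>xs. length xs = n \<Longrightarrow> evaluates t xs (b xs)"
    unfolding primrec_fun_def by blast
  from assms(2) obtain u where u: "mu_free u"
    "\<And>ys. length ys = Suc (Suc n) \<Longrightarrow> evaluates u ys (g (ys ! 0) (ys ! 1) (tl (tl ys)))"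
    unfolding primrec_fun_def by blast
  have ev: "evaluates (Prec t u) (k # xs) (rec_nat (b xs) (\<lambda>k y. g k y xs) k)"
    if "length xs = n" for k xs
  proof (induction k)
    case 0
    then show ?case using t that by (auto intro: evaluates.Prec_0)
  next
    case (Suc k)
    show ?case
      by (rule evaluates.Prec_Suc[OF Suc]) (use u(2)[of "k # _ # xs"] that in simp)
  qed
  have "primrec_fun (Suc n) (\<lambda>ys. rec_nat (b (tl ys)) (\<lambda>k y. g k y (tl ys)) (ys ! 0))"
    unfolding primrec_fun_def
  proof (intro exI[of _ "Prec t u"] conjI allI impI)
    fix ys :: "nat list" assume "length ys = Suc n"
    then show "evaluates (Prec t u) ys (rec_nat (b (tl ys)) (\<lambda>k y. g k y (tl ys)) (ys ! 0))"
      using ev by (cases ys) auto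
  qed (use t u in auto)
  from primrec_fun_app[OF this, of n "\<lambda>xs. a xs # xs"] assms(3) show ?thesis
    by (simp add: primrec_list_Cons primrec_list_id)
qed

section \<open>Arithmetic, Boolean connectives and case distinctions\<close>

lemma primrec_fun_Suc [pr_intros]:
  assumes "primrec_fun n a"
  shows "primrec_fun n (\<lambda>xs. Suc (a xs))"
proof -
  have "primrec_fun 1 (\<lambda>xs. Suc (xs ! 0))"
    unfolding primrec_fun_def
    by (intro exI[of _ Succ]) (auto simp: length_Suc_conv intro: evaluates.Succ)
  from primrec_fun_1[OF this assms] show ?thesis .
qed

lemma primrec_fun_add [pr_intros]:
  assumes "primrec_fun n a" "primrec_fun n b"
  shows "primrec_fun n (\<lambda>xs. a xs + b xs)"
proof -
  have "rec_nat x (\<lambda>k y. Suc y) z = x + z" for x z :: nat by (induction z) auto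
  moreover have "primrec_fun n (\<lambda>xs. rec_nat (a xs) (\<lambda>k y. Suc y) (b xs))"
    by (intro pr_intros assms; simp)
  ultimately show ?thesis by simp
qed

lemma primrec_fun_mult [pr_intros]:
  assumes "primrec_fun n a" "primrec_fun n b"
  shows "primrec_fun n (\<lambda>xs. a xs * b xs)"
proof -
  have "rec_nat 0 (\<lambda>k y. y + x) z = x * z" for x z :: nat by (induction z) auto
  moreover have "primrec_fun n (\<lambda>xs. rec_nat 0 (\<lambda>k y. y + a xs) (b xs))"
    by (intro pr_intros primrec_fun_app[OF assms(1)] assms(2); simp)
  ultimately show ?thesis by simp
qed

lemma primrec_fun_pred [pr_intros]:
  assumes "primrec_fun n a"
  shows "primrec_fun n (\<lambda>xs. a xs - 1)"
proof -
  have "rec_nat 0 (\<lambda>k y. k) z = z - 1" for z :: nat by (induction z) auto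
  moreover have "primrec_fun n (\<lambda>xs. rec_nat 0 (\<lambda>k y. k) (a xs))"
    by (intro pr_intros assms; simp)
  ultimately show ?thesis by simp
qed

lemma primrec_fun_diff [pr_intros]:
  assumes "primrec_fun n a" "primrec_fun n b"
  shows "primrec_fun n (\<lambda>xs. a xs - b xs)"
proof -
  have "rec_nat x (\<lambda>k y. y - 1) z = x - z" for x z :: nat by (induction z) auto
  moreover have "primrec_fun n (\<lambda>xs. rec_nat (a xs) (\<lambda>k y. y - 1) (b xs))"
    by (intro primrec_fun_rec_nat primrec_fun_pred primrec_fun_nth assms; simp)
  ultimately show ?thesis by simp
qed

lemma primrec_fun_not [pr_intros]:
  assumes "primrec_fun n (\<lambda>xs. of_bool (p xs))"
  shows "primrec_fun n (\<lambda>xs. of_bool (\<not> p xs))"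
proof -
  have "primrec_fun n (\<lambda>xs. 1 - of_bool (p xs))" by (intro pr_intros assms)
  then show ?thesis by (rule primrec_fun_cong) auto
qed

lemma primrec_fun_conj [pr_intros]:
  assumes "primrec_fun n (\<lambda>xs. of_bool (p xs))" "primrec_fun n (\<lambda>xs. of_bool (q xs))"
  shows "primrec_fun n (\<lambda>xs. of_bool (p xs \<and> q xs))"
proof -
  have "primrec_fun n (\<lambda>xs. of_bool (p xs) * of_bool (q xs))" by (intro pr_intros assms)
  then show ?thesis by (rule primrec_fun_cong) auto
qed

lemma primrec_fun_disj [pr_intros]:
  assumes "primrec_fun n (\<lambda>xs. of_bool (p xs))" "primrec_fun n (\<lambda>xs. of_bool (q xs))"
  shows "primrec_fun n (\<lambda>xs. of_bool (p xs \<or> q xs))"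
proof -
  have "primrec_fun n (\<lambda>xs. of_bool (\<not> (\<not> p xs \<and> \<not> q xs)))" by (intro pr_intros assms)
  then show ?thesis by simp
qed

lemma primrec_fun_le [pr_intros]:
  assumes "primrec_fun n a" "primrec_fun n b"
  shows "primrec_fun n (\<lambda>xs. of_bool (a xs \<le> b xs))"
proof -
  have "primrec_fun n (\<lambda>xs. 1 - (a xs - b xs))" by (intro primrec_fun_diff pr_intros assms)
  then show ?thesis by (rule primrec_fun_cong) auto
qed

lemma primrec_fun_less [pr_intros]:
  assumes "primrec_fun n a" "primrec_fun n b"
  shows "primrec_fun n (\<lambda>xs. of_bool (a xs < b xs))"
  using primrec_fun_le[OF primrec_fun_Suc[OF assms(1)] assms(2)] by (simp add: Suc_le_eq)

lemma primrec_fun_eq [pr_intros]: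
  assumes "primrec_fun n a" "primrec_fun n b"
  shows "primrec_fun n (\<lambda>xs. of_bool (a xs = b xs))"
proof -
  have "primrec_fun n (\<lambda>xs. of_bool (a xs \<le> b xs \<and> b xs \<le> a xs))" by (intro pr_intros assms)
  then show ?thesis by (rule primrec_fun_cong) auto
qed

lemma primrec_fun_if [pr_intros]:
  assumes "primrec_fun n (\<lambda>xs. of_bool (p xs))" "primrec_fun n a" "primrec_fun n b"
  shows "primrec_fun n (\<lambda>xs. if p xs then a xs else b xs)"
proof -
  have "primrec_fun n (\<lambda>xs. of_bool (p xs) * a xs + of_bool (\<not> p xs) * b xs)"
    by (intro pr_intros assms)
  then show ?thesis by (rule primrec_fun_cong) auto
qed

text \<open>A finite set can be hard-wired however it is defined; this is how non-uniform
  information about the tree enters.\<close>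

lemma primrec_fun_finite [pr_intros]:
  assumes "finite F" "primrec_fun n a"
  shows "primrec_fun n (\<lambda>xs. of_bool (a xs \<in> F))"
  using assms(1)
proof induction
  case empty
  then show ?case using primrec_fun_const[of n 0] by simp
next
  case (insert x F)
  have "primrec_fun n (\<lambda>xs. of_bool (a xs = x \<or> a xs \<in> F))"
    by (intro pr_intros assms insert)
  then show ?case by simp
qed

section \<open>Bounded sums, bounded quantifiers and counting\<close>

lemma primrec_fun_sum [pr_intros]:
  assumes "primrec_fun (Suc n) (\<lambda>ys. g (ys ! 0) (tl ys))" "primrec_fun n a"
  shows "primrec_fun n (\<lambda>xs. \<Sum>k<a xs. g k xs)"
proof -
  have "rec_nat 0 (\<lambda>k y. y + h k) m = (\<Sum>k<m. h k)" for h :: "nat \<Rightarrow> nat" and m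
    by (induction m) auto
  moreover have "primrec_fun n (\<lambda>xs. rec_nat 0 (\<lambda>k y. y + g k xs) (a xs))"
  proof (intro primrec_fun_rec_nat primrec_fun_add primrec_fun_const assms(2))
    show "primrec_fun (Suc (Suc n)) (\<lambda>ys. ys ! 1)" by (intro pr_intros) simp
    \<comment> \<open>The summand ignores the accumulated value, which is dropped from position 1 of
      the argument list.\<close>
    have "primrec_list (Suc (Suc n)) (Suc n) (\<lambda>ys. ys ! 0 # tl (tl ys))"
      by (intro pr_intros; simp)
    from primrec_fun_app[OF assms(1) this]
    show "primrec_fun (Suc (Suc n)) (\<lambda>ys. g (ys ! 0) (tl (tl ys)))" by simp
  qed
  ultimately show ?thesis by simp
qed

lemma primrec_fun_bex [pr_intros]:
  assumes "primrec_fun (Suc n) (\<lambda>ys. of_bool (p (ys ! 0) (tl ys)))" "primrec_fun n a"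
  shows "primrec_fun n (\<lambda>xs. of_bool (\<exists>k<a xs. p k xs))"
proof -
  have "primrec_fun n (\<lambda>xs. of_bool (0 < (\<Sum>k<a xs. of_bool (p k xs) :: nat)))"
    by (intro primrec_fun_less primrec_fun_sum primrec_fun_const assms)
  moreover have "0 < (\<Sum>k<m. of_bool (q k) :: nat) \<longleftrightarrow> (\<exists>k<m. q k)" for m and q :: "nat \<Rightarrow> bool"
    by (auto simp: zero_less_iff_neq_zero)
  ultimately show ?thesis by simp
qed

lemma primrec_fun_ball [pr_intros]:
  assumes "primrec_fun (Suc n) (\<lambda>ys. of_bool (p (ys ! 0) (tl ys)))" "primrec_fun n a"
  shows "primrec_fun n (\<lambda>xs. of_bool (\<forall>k<a xs. p k xs))"
proof -
  have "primrec_fun n (\<lambda>xs. of_bool (\<not> (\<exists>k<a xs. \<not> p k xs)))"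
    by (intro primrec_fun_not primrec_fun_bex assms)
  then show ?thesis by simp
qed

lemma primrec_fun_card [pr_intros]:
  assumes "primrec_fun (Suc n) (\<lambda>ys. of_bool (p (ys ! 0) (tl ys)))" "primrec_fun n a"
  shows "primrec_fun n (\<lambda>xs. card {k. k < a xs \<and> p k xs})"
proof -
  have "primrec_fun n (\<lambda>xs. \<Sum>k<a xs. of_bool (p k xs) :: nat)" by (intro pr_intros assms)
  moreover have "(\<Sum>k<m. of_bool (q k) :: nat) = card {k. k < m \<and> q k}" for m and q :: "nat \<Rightarrow> bool"
    by (auto simp: sum.If_cases of_bool_def intro!: arg_cong[where f=card])
  ultimately show ?thesis by simp
qed

section \<open>Codes of pairs and lists\<close>

lemma primrec_fun_triangle:
  assumes "primrec_fun n a"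
  shows "primrec_fun n (\<lambda>xs. triangle (a xs))"
proof -
  have "triangle m = (\<Sum>k<m. Suc k)" for m by (induction m) auto
  moreover have "primrec_fun n (\<lambda>xs. \<Sum>k<a xs. Suc k)" by (intro pr_intros assms; simp)
  ultimately show ?thesis by simp
qed

lemma primrec_fun_prod_encode [pr_intros]:
  assumes "primrec_fun n a" "primrec_fun n b"
  shows "primrec_fun n (\<lambda>xs. prod_encode (a xs, b xs))"
  unfolding prod_encode_def by (simp, intro pr_intros primrec_fun_triangle assms)

text \<open>Both components of a pair are bounded by its code, so the projection is a bounded
  search, written as a sum to which only the true component contributes.\<close>

lemma primrec_fun_fst_prod_decode [pr_intros]:
  assumes "primrec_fun n a"
  shows "primrec_fun n (\<lambda>xs. fst (prod_decode (a xs)))"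
proof -
  have eq: "(\<Sum>x<Suc m. x * of_bool (\<exists>y<Suc m. prod_encode (x, y) = m)) = fst (prod_decode m)" for m
  proof -
    obtain u v where uv: "m = prod_encode (u, v)" by (metis prod_decode_inverse surj_pair)
    have *: "x * of_bool (\<exists>y<Suc m. prod_encode (x, y) = m) = (if x = u then u else 0)" for x
      using le_prod_encode_2[of v u] by (auto simp: uv)
    show ?thesis unfolding * using le_prod_encode_1[of u v] by (simp add: uv)
  qed
  have "primrec_fun 1 (\<lambda>xs. \<Sum>x<Suc (xs ! 0). x * of_bool (\<exists>y<Suc (xs ! 0). prod_encode (x, y) = xs ! 0))"
    by (intro pr_intros) simp_all
  from primrec_fun_1[OF this[unfolded eq] assms] show ?thesis .
qed

lemma primrec_fun_snd_prod_decode [pr_intros]: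
  assumes "primrec_fun n a"
  shows "primrec_fun n (\<lambda>xs. snd (prod_decode (a xs)))"
proof -
  have eq: "(\<Sum>y<Suc m. y * of_bool (\<exists>x<Suc m. prod_encode (x, y) = m)) = snd (prod_decode m)" for m
  proof -
    obtain u v where uv: "m = prod_encode (u, v)" by (metis prod_decode_inverse surj_pair)
    have *: "y * of_bool (\<exists>x<Suc m. prod_encode (x, y) = m) = (if y = v then v else 0)" for y
      using le_prod_encode_1[of u v] by (auto simp: uv)
    show ?thesis unfolding * using le_prod_encode_2[of v u] by (simp add: uv)
  qed
  have "primrec_fun 1 (\<lambda>xs. \<Sum>y<Suc (xs ! 0). y * of_bool (\<exists>x<Suc (xs ! 0). prod_encode (x, y) = xs ! 0))"
    by (intro pr_intros) simp_all
  from primrec_fun_1[OF this[unfolded eq] assms] show ?thesis .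
qed

text \<open>A nonempty list is coded as the successor of the pair of its head and the code of its
  tail, so each iteration passes to the tail.\<close>

definition drop_code :: "nat \<Rightarrow> nat \<Rightarrow> nat" where
  "drop_code k c = rec_nat c (\<lambda>_ y. snd (prod_decode (y - 1))) k"

definition nth_code :: "nat \<Rightarrow> nat \<Rightarrow> nat" where
  "nth_code k c = fst (prod_decode (drop_code k c - 1))"

lemma primrec_fun_drop_code [pr_intros]:
  "primrec_fun n a \<Longrightarrow> primrec_fun n b \<Longrightarrow> primrec_fun n (\<lambda>xs. drop_code (a xs) (b xs))"
  unfolding drop_code_def
  by (intro primrec_fun_rec_nat primrec_fun_snd_prod_decode primrec_fun_pred primrec_fun_nth; simp)

lemma primrec_fun_nth_code [pr_intros]:
  "primrec_fun n a \<Longrightarrow> primrec_fun n b \<Longrightarrow> primrec_fun n (\<lambda>xs. nth_code (a xs) (b xs))"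
  unfolding nth_code_def by (intro pr_intros)

lemma drop_code_list_encode:
  assumes "k \<le> length xs"
  shows "drop_code k (list_encode xs) = list_encode (drop k xs)"
  using assms
proof (induction k)
  case 0
  then show ?case by (simp add: drop_code_def)
next
  case (Suc k)
  then have "drop k xs = xs ! k # drop (Suc k) xs" by (simp add: Cons_nth_drop_Suc)
  moreover have "drop_code (Suc k) c = snd (prod_decode (drop_code k c - 1))" for c
    by (simp add: drop_code_def)
  ultimately show ?case using Suc by (simp add: prod_encode_inverse)
qed

lemma nth_code_list_encode:
  assumes "k < length xs"
  shows "nth_code k (list_encode xs) = xs ! k"
proof -
  have "drop k xs = xs ! k # drop (Suc k) xs" using assms by (simp add: Cons_nth_drop_Suc)
  then show ?thesis using assms by (simp add: nth_code_def drop_code_list_encode)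
qed

lemma list_encode_eq_0_iff: "list_encode xs = 0 \<longleftrightarrow> xs = []"
  by (cases xs) auto

text \<open>Only the empty list has code 0, so the length is the first number of dropped entries
  that leaves code 0. Stated on codes with a bounded quantifier, this is a primitive recursive
  test.\<close>

lemma length_list_code_iff:
  "length xs = n \<longleftrightarrow> (\<forall>k<n. drop_code k (list_encode xs) \<noteq> 0) \<and> drop_code n (list_encode xs) = 0"
proof
  assume "length xs = n"
  then show "(\<forall>k<n. drop_code k (list_encode xs) \<noteq> 0) \<and> drop_code n (list_encode xs) = 0"
    by (auto simp: drop_code_list_encode list_encode_eq_0_iff)
next
  assume *: "(\<forall>k<n. drop_code k (list_encode xs) \<noteq> 0) \<and> drop_code n (list_encode xs) = 0"
  have "\<not> length xs < n"
    using * drop_code_list_encode[of "length xs" xs] by (auto simp: list_encode_eq_0_iff)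
  moreover then have "drop n xs = []"
    using * by (simp add: drop_code_list_encode list_encode_eq_0_iff)
  ultimately show "length xs = n" by simp
qed

subsection \<open>Step-bounded evaluation\<close>

text \<open>The first argument is a budget. Answers must be correct at every budget and present from
  some budget on; the latter lets finitely many subcomputations share one budget.\<close>

definition step_bounded :: "nat \<Rightarrow> rec_term \<Rightarrow> (nat list \<Rightarrow> nat) \<Rightarrow> bool" where
  "step_bounded n t F \<longleftrightarrow>
    primrec_fun (Suc n) F \<and>
    (\<forall>xs k y. length xs = n \<longrightarrow> F (k # xs) = Suc y \<longrightarrow> evaluates t xs y) \<and>
    (\<forall>xs y. length xs = n \<longrightarrow> evaluates t xs y \<longrightarrow> (\<exists>k0. \<forall>k\<ge>k0. F (k # xs) = Suc y))"

lemma step_boundedD: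
  assumes "step_bounded n t F"
  shows "primrec_fun (Suc n) F"
    and "length xs = n \<Longrightarrow> F (k # xs) = Suc y \<Longrightarrow> evaluates t xs y"
    and "length xs = n \<Longrightarrow> evaluates t xs y \<Longrightarrow> \<exists>k0. \<forall>k\<ge>k0. F (k # xs) = Suc y"
  using assms unfolding step_bounded_def by blast+

lemma primrec_fun_ex_zero:
  assumes "\<forall>G\<in>set Gs. primrec_fun n G"
  shows "primrec_fun n (\<lambda>xs. of_bool (\<exists>G\<in>set Gs. G xs = 0))"
  using assms
proof (induction Gs)
  case Nil
  then show ?case using primrec_fun_const[of n 0] by simp
next
  case (Cons G Gs)
  have "primrec_fun n (\<lambda>xs. of_bool (G xs = 0 \<or> (\<exists>G\<in>set Gs. G xs = 0)))"
    by (intro pr_intros) (use Cons in auto)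
  then show ?case by simp
qed

text \<open>All subterms run on the same budget. One inconclusive argument makes the result
  inconclusive, since \<open>Comp\<close> requires every argument to converge, even one that
  \<open>f\<close> ignores.\<close>

lemma step_bounded_Comp:
  assumes f: "step_bounded (length gs) f Ff" and gs: "list_all2 (step_bounded n) gs Gs"
  shows "step_bounded n (Comp f gs)
    (\<lambda>ys. if \<exists>G\<in>set Gs. G ys = 0 then 0 else Ff (ys ! 0 # map (\<lambda>G. G ys - 1) Gs))"
    (is "step_bounded n _ ?F")
  unfolding step_bounded_def
proof (intro conjI allI impI)
  have len: "length Gs = length gs" using gs by (simp add: list_all2_lengthD)
  have G: "step_bounded n (gs ! i) (Gs ! i)" if "i < length gs" for i
    using gs that by (simp add: list_all2_conv_all_nth)
  have pG: "primrec_fun (Suc n) G" if "G \<in> set Gs" for G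
    using that G len by (auto simp: in_set_conv_nth step_bounded_def)
  have "primrec_list (Suc n) (length gs) (\<lambda>ys. map (\<lambda>G. G ys - 1) Gs)"
    unfolding primrec_list_def
  proof (intro conjI allI impI)
    fix i assume i: "i < length gs"
    have "primrec_fun (Suc n) (\<lambda>ys. (Gs ! i) ys - 1)"
      by (intro primrec_fun_pred pG) (use i len in auto)
    then show "primrec_fun (Suc n) (\<lambda>ys. map (\<lambda>G. G ys - 1) Gs ! i)"
      using i len by simp
  qed (use len in simp)
  then have L: "primrec_list (Suc n) (Suc (length gs)) (\<lambda>ys. ys ! 0 # map (\<lambda>G. G ys - 1) Gs)"
    by (intro primrec_list_Cons primrec_fun_nth) auto
  have "primrec_fun (Suc (length gs)) Ff" using f by (simp add: step_bounded_def)
  from primrec_fun_app[OF this L]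
  show "primrec_fun (Suc n) ?F"
    by (intro primrec_fun_if primrec_fun_ex_zero primrec_fun_const ballI) (auto intro: pG)
next
  fix xs k y assume xs: "length xs = n" and F: "?F (k # xs) = Suc y"
  let ?ys = "map (\<lambda>G. G (k # xs) - 1) Gs"
  have len: "length Gs = length gs" using gs by (simp add: list_all2_lengthD)
  have nz: "G (k # xs) \<noteq> 0" if "G \<in> set Gs" for G using F that by (auto split: if_splits)
  show "evaluates (Comp f gs) xs y"
  proof (rule evaluates.Comp[where ys="?ys"])
    show "list_all2 (\<lambda>g y. evaluates g xs y) gs ?ys"
      unfolding list_all2_conv_all_nth
    proof (intro conjI allI impI)
      fix i assume i: "i < length gs"
      then have "(Gs ! i) (k # xs) = Suc (?ys ! i)" using nz[of "Gs ! i"] len by simp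
      with i gs xs show "evaluates (gs ! i) xs (?ys ! i)"
        unfolding list_all2_conv_all_nth step_bounded_def by blast
    qed (use len in simp)
    have "Ff (k # ?ys) = Suc y" using F by (auto split: if_splits)
    then show "evaluates f ?ys y"
      using f len unfolding step_bounded_def by (metis length_map)
  qed
next
  fix xs y assume xs: "length xs = n" and ev: "evaluates (Comp f gs) xs y"
  have len: "length Gs = length gs" using gs by (simp add: list_all2_lengthD)
  from ev obtain ys where ys: "list_all2 (\<lambda>g y. evaluates g xs y) gs ys" "evaluates f ys y"
    by (rule evaluates_elims(4))
  have "length ys = length gs" using ys(1) by (simp add: list_all2_lengthD)
  with f ys(2) obtain kf where kf: "\<And>k. k \<ge> kf \<Longrightarrow> Ff (k # ys) = Suc y"
    unfolding step_bounded_def by blast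
  have "\<forall>i<length gs. \<exists>k0. \<forall>k\<ge>k0. (Gs ! i) (k # xs) = Suc (ys ! i)"
    using gs ys(1) xs unfolding list_all2_conv_all_nth step_bounded_def by metis
  then obtain kg where kg: "\<And>i k. i < length gs \<Longrightarrow> k \<ge> kg i \<Longrightarrow> (Gs ! i) (k # xs) = Suc (ys ! i)"
    by metis
  show "\<exists>k0. \<forall>k\<ge>k0. ?F (k # xs) = Suc y"
  \<comment> \<open>The sum bounds every individual threshold, so this budget serves
    \<open>f\<close> and all its arguments.\<close>
  proof (intro exI[of _ "kf + (\<Sum>i<length gs. kg i)"] allI impI)
    fix k assume k: "k \<ge> kf + (\<Sum>i<length gs. kg i)"
    have *: "(Gs ! i) (k # xs) = Suc (ys ! i)" if "i < length gs" for i
    proof (rule kg[OF that])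
      have "kg i \<le> (\<Sum>i<length gs. kg i)" using that by (intro member_le_sum) auto
      with k show "kg i \<le> k" by linarith
    qed
    have "map (\<lambda>G. G (k # xs) - 1) Gs = ys"
      using * len \<open>length ys = _\<close> by (intro nth_equalityI) auto
    moreover have "\<not> (\<exists>G\<in>set Gs. G (k # xs) = 0)" using * len by (auto simp: in_set_conv_nth)
    ultimately show "?F (k # xs) = Suc y" using kf k by simp
  qed
qed

text \<open>The budget comes first, then the recursion counter, then the parameters. The shifted
  result is carried along the recursion, and an inconclusive 0 is propagated to the end.\<close>

lemma step_bounded_Prec:
  assumes f: "step_bounded n f Ff" and g: "step_bounded (Suc (Suc n)) g Fg"
  shows "step_bounded (Suc n) (Prec f g)
    (\<lambda>ys. rec_nat (Ff (ys ! 0 # tl (tl ys)))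
       (\<lambda>j y. if y = 0 then 0 else Fg (ys ! 0 # j # (y - 1) # tl (tl ys))) (ys ! 1))"
    (is "step_bounded _ _ ?F")
  unfolding step_bounded_def
proof (intro conjI allI impI)
  have pf: "primrec_fun (Suc n) Ff" and pg: "primrec_fun (Suc (Suc (Suc n))) Fg"
    using f g by (simp_all add: step_bounded_def)
  show "primrec_fun (Suc (Suc n)) ?F"
    by (intro primrec_fun_app[OF pf] primrec_fun_app[OF pg] pr_intros) simp_all
next
  fix xs k y assume xs: "length xs = Suc n" and F: "?F (k # xs) = Suc y"
  obtain x zs where xz: "xs = x # zs" "length zs = n" using xs by (cases xs) auto
  have "?F (k # x # zs) = Suc y \<Longrightarrow> evaluates (Prec f g) (x # zs) y" for y
  proof (induction x arbitrary: y)
    case 0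
    then show ?case using f xz by (auto simp: step_bounded_def intro: evaluates.Prec_0)
  next
    case (Suc x)
    let ?w = "?F (k # x # zs)"
    have w: "?w \<noteq> 0" "Fg (k # x # (?w - 1) # zs) = Suc y" using Suc.prems by (auto split: if_splits cong: if_cong)
    have "evaluates (Prec f g) (x # zs) (?w - 1)" using w(1) by (intro Suc.IH) simp
    moreover have "evaluates g (x # (?w - 1) # zs) y"
      by (rule step_boundedD(2)[OF g _ w(2)]) (use xz(2) in simp)
    ultimately show ?case by (rule evaluates.Prec_Suc)
  qed
  then show "evaluates (Prec f g) xs y" using F xz by blast
next
  fix xs y assume xs: "length xs = Suc n" and ev: "evaluates (Prec f g) xs y"
  obtain x zs where xz: "xs = x # zs" "length zs = n" using xs by (cases xs) auto
  have "evaluates (Prec f g) (x # zs) y \<Longrightarrow> \<exists>k0. \<forall>k\<ge>k0. ?F (k # x # zs) = Suc y" for y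
  proof (induction x arbitrary: y)
    case 0
    then have "evaluates f zs y" by (rule evaluates_elims(5))
    then show ?case using f xz by (auto simp: step_bounded_def)
  next
    case (Suc x)
    then obtain w where w: "evaluates (Prec f g) (x # zs) w" "evaluates g (x # w # zs) y"
      by (auto elim: evaluates_elims(6))
    obtain k1 where k1: "\<And>k. k \<ge> k1 \<Longrightarrow> ?F (k # x # zs) = Suc w" using Suc.IH[OF w(1)] by blast
    have "length (x # w # zs) = Suc (Suc n)" using xz by simp
    then obtain k2 where k2: "\<And>k. k \<ge> k2 \<Longrightarrow> Fg (k # x # w # zs) = Suc y"
      using g w(2) unfolding step_bounded_def by blast
    show ?case
      by (intro exI[of _ "max k1 k2"] allI impI) (use k1 k2 in \<open>simp cong: if_cong\<close>)
  qed
  then show "\<exists>k0. \<forall>k\<ge>k0. ?F (k # xs) = Suc y" using ev xz by blast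
qed

text \<open>The shifted value 1 means that \<open>f\<close> returned 0, and a value above 1 that it
  returned a positive number. At most one summand is nonzero: the one for a zero of \<open>f\<close>
  below which \<open>f\<close> is conclusively positive. So the sum is the shifted minimum, or 0 if
  the search fails.\<close>

lemma step_bounded_Mu:
  assumes f: "step_bounded (Suc n) f Ff"
  shows "step_bounded n (Mu f)
    (\<lambda>ys. \<Sum>m<ys ! 0. Suc m *
      of_bool (Ff (ys ! 0 # m # tl ys) = 1 \<and> (\<forall>l<m. 1 < Ff (ys ! 0 # l # tl ys))))"
    (is "step_bounded _ _ ?F")
  unfolding step_bounded_def
proof (intro conjI allI impI)
  have pf: "primrec_fun (Suc (Suc n)) Ff" using f by (simp add: step_bounded_def)
  show "primrec_fun (Suc n) ?F"
    by (intro primrec_fun_app[OF pf] pr_intros) simp_all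
next
  fix xs k y assume xs: "length xs = n" and F: "?F (k # xs) = Suc y"
  let ?Q = "\<lambda>m. Ff (k # m # xs) = 1 \<and> (\<forall>l<m. 1 < Ff (k # l # xs))"
  have "\<exists>m<k. ?Q m"
  proof (rule ccontr)
    assume "\<not> ?thesis"
    then have "?F (k # xs) = 0" by (auto simp: nth_Cons')
    with F show False by simp
  qed
  then obtain m where m: "m < k" "?Q m" by blast
  \<comment> \<open>Of two such numbers, the smaller would have a value both equal to 1 and above
    1.\<close>
  have "?Q m' \<longleftrightarrow> m' = m" for m'
    using m(2) by (metis linorder_neqE_nat less_irrefl)
  then have "?F (k # xs) = Suc m"
    using m(1) by (simp add: of_bool_def if_distrib sum.delta cong: if_cong)
  with F have y: "y = m" by simp
  show "evaluates (Mu f) xs y"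
    unfolding y
  proof (rule evaluates.Mu)
    show "evaluates f (m # xs) 0"
      using f m(2) xs unfolding step_bounded_def by (metis One_nat_def length_Cons)
    show "\<forall>l<m. \<exists>y. evaluates f (l # xs) (Suc y)"
    proof (intro allI impI)
      fix l assume "l < m"
      then have "1 < Ff (k # l # xs)" using m(2) by blast
      then obtain z where "Ff (k # l # xs) = Suc (Suc z)" by (metis One_nat_def less_natE add_Suc plus_nat.add_0)
      then show "\<exists>y. evaluates f (l # xs) (Suc y)"
        using f xs unfolding step_bounded_def by (metis length_Cons)
    qed
  qed
next
  fix xs m assume xs: "length xs = n" and ev: "evaluates (Mu f) xs m"
  from ev have ev: "evaluates f (m # xs) 0" "\<forall>l<m. \<exists>y. evaluates f (l # xs) (Suc y)"
    by (blast elim: evaluates_elims(7))+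
  obtain k1 where k1: "\<And>k. k \<ge> k1 \<Longrightarrow> Ff (k # m # xs) = 1"
    using f ev(1) xs unfolding step_bounded_def by (metis One_nat_def length_Cons)
  have "\<forall>l<m. \<exists>k0. \<forall>k\<ge>k0. 1 < Ff (k # l # xs)"
  proof (intro allI impI)
    fix l assume "l < m"
    then obtain y where "evaluates f (l # xs) (Suc y)" using ev(2) by blast
    then have "\<exists>k0. \<forall>k\<ge>k0. Ff (k # l # xs) = Suc (Suc y)"
      using f xs unfolding step_bounded_def by (metis length_Cons)
    then show "\<exists>k0. \<forall>k\<ge>k0. 1 < Ff (k # l # xs)" by fastforce
  qed
  then obtain k2 where k2: "\<And>l k. l < m \<Longrightarrow> k \<ge> k2 l \<Longrightarrow> 1 < Ff (k # l # xs)" by metis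
  show "\<exists>k0. \<forall>k\<ge>k0. ?F (k # xs) = Suc m"
  \<comment> \<open>The extra \<open>Suc m\<close> puts \<open>m\<close> inside the range of the
    search, which runs only below the budget.\<close>
  proof (intro exI[of _ "k1 + (\<Sum>l<m. k2 l) + Suc m"] allI impI)
    fix k assume k: "k \<ge> k1 + (\<Sum>l<m. k2 l) + Suc m"
    let ?Q = "\<lambda>m. Ff (k # m # xs) = 1 \<and> (\<forall>l<m. 1 < Ff (k # l # xs))"
    have "1 < Ff (k # l # xs)" if "l < m" for l
    proof (rule k2[OF that])
      have "k2 l \<le> (\<Sum>l<m. k2 l)" using that by (intro member_le_sum) auto
      with k show "k2 l \<le> k" by linarith
    qed
    moreover have "Ff (k # m # xs) = 1" using k k1 by simp
    ultimately have "?Q m' \<longleftrightarrow> m' = m" for m'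
      by (metis linorder_neqE_nat less_irrefl)
    then show "?F (k # xs) = Suc m"
      using k by (simp add: of_bool_def if_distrib sum.delta cong: if_cong)
  qed
qed

text \<open>
  Kleene's normal form for one fixed term: \<open>F (k # xs)\<close> is \<open>Suc y\<close> if the computation yields
  \<open>y\<close> when all unbounded searches are cut off at \<open>k\<close>, and \<open>0\<close> if it is inconclusive.
  Recursion on the term avoids coding terms and computations.
\<close>

lemma step_bounded_exists: "\<exists>F. step_bounded n t F"
proof (induction t arbitrary: n)
  case Zero
  have "step_bounded n Zero (\<lambda>_. 1)"
    by (auto simp: step_bounded_def intro: primrec_fun_const evaluates.Zero elim: evaluates_elims)
  then show ?case by blast
next
  case Succ
  show ?case
  proof (cases "n = 1")
    case True
    have "primrec_fun (Suc 1) (\<lambda>ys. Suc (Suc (ys ! 1)))" by (intro pr_intros) simp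
    then have "step_bounded n Succ (\<lambda>ys. Suc (Suc (ys ! 1)))"
      using True by (auto simp: step_bounded_def length_Suc_conv intro: evaluates.Succ elim: evaluates_elims)
    then show ?thesis by blast
  next
    case False
    have "step_bounded n Succ (\<lambda>_. 0)"
      using False by (auto simp: step_bounded_def intro: primrec_fun_const elim: evaluates_elims)
    then show ?thesis by blast
  qed
next
  case (Proj i)
  show ?case
  proof (cases "i < n")
    case True
    have "primrec_fun (Suc n) (\<lambda>ys. Suc (ys ! Suc i))" by (intro pr_intros) (use True in simp)
    then have "step_bounded n (Proj i) (\<lambda>ys. Suc (ys ! Suc i))"
      using True by (auto simp: step_bounded_def intro: evaluates.Proj elim: evaluates_elims)
    then show ?thesis by blast
  next
    case False
    have "step_bounded n (Proj i) (\<lambda>_. 0)"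
      using False by (auto simp: step_bounded_def intro: primrec_fun_const elim: evaluates_elims)
    then show ?thesis by blast
  qed
next
  case (Comp f gs)
  obtain Ff where "step_bounded (length gs) f Ff" using Comp.IH(1) by blast
  moreover have "\<forall>g\<in>set gs. \<exists>F. step_bounded n g F" using Comp.IH(2) by blast
  from bchoice[OF this] obtain G where "\<forall>g\<in>set gs. step_bounded n g (G g)" by blast
  then have "list_all2 (step_bounded n) gs (map G gs)" by (simp add: list_all2_conv_all_nth)
  ultimately show ?case using step_bounded_Comp by blast
next
  case (Prec f g)
  show ?case
  proof (cases n)
    case 0
    have "\<not> evaluates (Prec f g) [] y" for y
      by (rule notI, erule evaluates.cases) simp_all
    then have "step_bounded n (Prec f g) (\<lambda>_. 0)"
      using 0 by (auto simp: step_bounded_def intro: primrec_fun_const)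
    then show ?thesis by blast
  next
    case (Suc m)
    obtain Ff Fg where "step_bounded m f Ff" "step_bounded (Suc (Suc m)) g Fg"
      using Prec.IH by blast
    then show ?thesis using step_bounded_Prec Suc by blast
  qed
next
  case (Mu f)
  then obtain Ff where "step_bounded (Suc n) f Ff" by blast
  then show ?case using step_bounded_Mu by blast
qed

subsection \<open>Enumerating the edges\<close>

text \<open>
  A value \<open>e s = 0\<close> means that stage \<open>s\<close> enumerates nothing. Every edge recurs infinitely often, so
  that waiting for a condition that holds from some stage on never loses an edge.
\<close>

definition edge_enum :: "(nat \<Rightarrow> nat) \<Rightarrow> (nat \<times> nat) set \<Rightarrow> bool" where
  "edge_enum e E \<longleftrightarrow>
    primrec_fun 1 (\<lambda>xs. e (xs ! 0)) \<and>
    (\<forall>s. e s \<noteq> 0 \<longrightarrow> prod_decode (e s - 1) \<in> E) \<and>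
    (\<forall>p\<in>E. infinite {s. e s = Suc (prod_encode p)}) \<and>
    infinite {s. e s = 0}"

text \<open>Looking at the end of a tuple is enough: in a prefix tree, any two consecutive entries
  of a tuple are the last two of one of its prefixes.\<close>

definition tree_edges :: "'a rel_structure \<Rightarrow> ('a \<times> 'a) set" where
  "tree_edges T = {(a, b). \<exists>n xs. xs @ [a, b] \<in> relation T n}"

text \<open>Membership in the relations is merely computable, so a stage codes a triple of budget,
  index and tuple, and reports the last two entries if the budget confirms membership. Letting the
  budget grow repeats each edge infinitely often.\<close>

lemma edge_enum_tree_edges:
  assumes "computable_fun 2 (relations_char T)" and len: "\<And>n xs. xs \<in> relation T n \<Longrightarrow> length xs = Suc n"
  shows "\<exists>e. edge_enum e (tree_edges T)"
proof -
  obtain t where t: "\<And>xs. length xs = 2 \<Longrightarrow> evaluates t xs (relations_char T xs)"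
    using assms(1) unfolding computable_fun_def by blast
  obtain F where F: "step_bounded 2 t F" using step_bounded_exists by blast
  have pF: "primrec_fun 3 F" using F by (simp add: step_bounded_def eval_nat_numeral)
  have F_sound: "list_decode c \<in> relation T n" if "F [k, n, c] = 2" for k n c
  proof -
    have "evaluates t [n, c] 1"
      using F that unfolding step_bounded_def
      by (metis One_nat_def length_Cons list.size(3) numeral_2_eq_2)
    then have "relations_char T [n, c] = 1" using t[of "[n, c]"] evaluates_deterministic by force
    then show ?thesis by (simp add: relations_char_def of_bool_def split: if_splits)
  qed
  have F_complete: "\<exists>k0. \<forall>k\<ge>k0. F [k, n, list_encode xs] = 2" if "xs \<in> relation T n" for n xs
  proof -
    have "relations_char T [n, list_encode xs] = 1" using that by (simp add: relations_char_def)
    then have "evaluates t [n, list_encode xs] 1" using t[of "[n, list_encode xs]"] by simp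
    then show ?thesis using F unfolding step_bounded_def
      by (metis One_nat_def length_Cons list.size(3) numeral_2_eq_2)
  qed
  \<comment> \<open>The value 2 is the shifted answer 1, that is, confirmed membership. Index 0 is
    the unary root relation, whose tuples contain no edge.\<close>
  define en where "en k n c = (if F [k, n, c] = 2 \<and> 0 < n
    then Suc (prod_encode (nth_code (n - 1) c, nth_code n c)) else 0)" for k n c
  define e where "e s = en (fst (prod_decode s)) (fst (prod_decode (snd (prod_decode s))))
    (snd (prod_decode (snd (prod_decode s))))" for s
  have e_encode: "e (prod_encode (k, prod_encode (n, c))) = en k n c" for k n c
    by (simp add: e_def)
  have inj: "inj (\<lambda>k. prod_encode (k, m))" for m by (simp add: inj_on_def)
  have inf: "infinite {s. e s = v}" if "\<And>k. k \<ge> k0 \<Longrightarrow> en k n c = v" for v k0 n c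
  proof
    assume fin: "finite {s. e s = v}"
    have "(\<lambda>k. prod_encode (k, prod_encode (n, c))) ` {k0..} \<subseteq> {s. e s = v}"
      using that by (auto simp: e_encode)
    then have "finite ((\<lambda>k. prod_encode (k, prod_encode (n, c))) ` {k0..})"
      using fin finite_subset by blast
    then have "finite {k0..}" using finite_imageD[OF _ inj_on_subset[OF inj]] by blast
    then show False by (simp add: infinite_Ici)
  qed
  have "edge_enum e (tree_edges T)"
    unfolding edge_enum_def
  proof (intro conjI allI impI ballI)
    show "primrec_fun 1 (\<lambda>xs. e (xs ! 0))"
      unfolding e_def en_def
      by (intro primrec_fun_app[OF pF] pr_intros) (simp_all add: eval_nat_numeral pr_intros)
    \<comment> \<open>Stages with index 0 are silent at every budget.\<close>
    show "infinite {s. e s = 0}" by (rule inf[of 0 0 0]) (simp add: en_def)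
    show "prod_decode (e s - 1) \<in> tree_edges T" if "e s \<noteq> 0" for s
    proof -
      obtain k n c where s: "s = prod_encode (k, prod_encode (n, list_encode c))"
        by (metis prod_decode_inverse surj_pair list_decode_inverse)
      with that have *: "F [k, n, list_encode c] = 2" "0 < n"
        and es: "e s = Suc (prod_encode (nth_code (n - 1) (list_encode c), nth_code n (list_encode c)))"
        by (auto simp: e_encode en_def split: if_splits)
      from F_sound[OF *(1)] have c: "c \<in> relation T n" by simp
      then have l: "length c = Suc n" by (rule len)
      obtain m where m: "n = Suc m" using *(2) by (cases n) auto
      have "c = take (n - 1) c @ [c ! (n - 1), c ! n]"
        using l take_Suc_conv_app_nth[of "Suc m" c] take_Suc_conv_app_nth[of m c] by (simp add: m)
      with c have "(c ! (n - 1), c ! n) \<in> tree_edges T" unfolding tree_edges_def by auto metis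
      then show ?thesis using l *(2) by (simp add: es nth_code_list_encode)
    qed
    show "infinite {s. e s = Suc (prod_encode p)}" if "p \<in> tree_edges T" for p
    proof -
      obtain a b n xs where p: "p = (a, b)" "xs @ [a, b] \<in> relation T n"
        using \<open>p \<in> tree_edges T\<close> unfolding tree_edges_def by auto
      obtain k0 where k0: "\<And>k. k \<ge> k0 \<Longrightarrow> F [k, n, list_encode (xs @ [a, b])] = 2"
        using F_complete[OF p(2)] by blast
      have n: "n = Suc (length xs)" using len[OF p(2)] by simp
      show ?thesis
        by (rule inf[of k0 n "list_encode (xs @ [a, b])"])
          (use k0 in \<open>simp add: en_def p(1) n nth_code_list_encode nth_append\<close>)
    qed
  qed
  then show ?thesis by blast
qed

subsection \<open>Relabelling an enumerated forest\<close>

text \<open>The rank inverts the increasing enumeration of \<open>A\<close>. It counts below a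
  bound, hence is primitive recursive whenever membership in \<open>A\<close> is, whereas the
  enumeration itself may grow too fast.\<close>

lemma bij_betw_rank:
  fixes A :: "nat set"
  assumes "infinite A"
  shows "bij_betw (\<lambda>s. card {k. k < s \<and> k \<in> A}) A UNIV"
proof -
  have *: "card {k. k < enumerate A n \<and> k \<in> A} = n" for n
  proof -
    have "{k. k < enumerate A n \<and> k \<in> A} = enumerate A ` {..<n}"
    proof
      show "{k. k < enumerate A n \<and> k \<in> A} \<subseteq> enumerate A ` {..<n}"
        using assms enumerate_Ex[of A] by (fastforce simp: strict_mono_less[OF strict_mono_enumerate])
      show "enumerate A ` {..<n} \<subseteq> {k. k < enumerate A n \<and> k \<in> A}"
        using assms by (auto intro: enumerate_in_set enumerate_mono)
    qed
    then show ?thesis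
      using assms by (simp add: card_image strict_mono_imp_inj_on strict_mono_enumerate)
  qed
  have bij: "bij_betw (enumerate A) UNIV A" using assms by (rule bij_enumerate)
  have "bij_betw (inv_into UNIV (enumerate A)) A UNIV" by (rule bij_betw_inv_into[OF bij])
  moreover have "inv_into UNIV (enumerate A) s = card {k. k < s \<and> k \<in> A}" if s: "s \<in> A" for s
  proof -
    obtain n where "s = enumerate A n" using enumerate_Ex[OF assms s] by metis
    then show ?thesis using * bij by (simp add: bij_betw_def)
  qed
  ultimately show ?thesis by (simp cong: bij_betw_cong)
qed

lemma infinite_nat_sets_bij:
  fixes A B :: "nat set"
  assumes "infinite A" "infinite B"
  shows "\<exists>f. bij_betw f A B"
  using bij_betw_trans[OF bij_betw_rank[OF assms(1)] bij_enumerate[OF assms(2)]] by blast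

section \<open>Placing tree nodes by stages\<close>

text \<open>What remains of an injective prefix tree when only its edges are kept. By
  \<open>Domain_E\<close> every parent lies in the tree \<open>insert r (Range E)\<close>, so the
  elements of \<open>D\<close> outside it have no edges at all.\<close>

locale enumerated_forest =
  fixes D :: "nat set" and r :: nat and E :: "(nat \<times> nat) set" and e :: "nat \<Rightarrow> nat"
  assumes E_subset: "E \<subseteq> D \<times> D"
    and root_in: "r \<in> D"
    and root_no_parent: "(a, r) \<notin> E"
    and Domain_E: "Domain E \<subseteq> insert r (Range E)"
    and irrefl_E: "(a, a) \<notin> E"
    and parent_unique: "(a, c) \<in> E \<Longrightarrow> (b, c) \<in> E \<Longrightarrow> a = b"
    and enum: "edge_enum e E"
begin

text \<open>At a silent stage \<open>src\<close> and \<open>tgt\<close> take the default value 0,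
  which carries no information.\<close>

definition src :: "nat \<Rightarrow> nat" where "src s = fst (prod_decode (e s - 1))"

definition tgt :: "nat \<Rightarrow> nat" where "tgt s = snd (prod_decode (e s - 1))"

lemma primrec_e [pr_intros]: "primrec_fun n a \<Longrightarrow> primrec_fun n (\<lambda>xs. e (a xs))"
  using enum unfolding edge_enum_def by (blast intro: primrec_fun_1)

lemma primrec_src [pr_intros]: "primrec_fun n a \<Longrightarrow> primrec_fun n (\<lambda>xs. src (a xs))"
  unfolding src_def by (intro pr_intros)

lemma primrec_tgt [pr_intros]: "primrec_fun n a \<Longrightarrow> primrec_fun n (\<lambda>xs. tgt (a xs))"
  unfolding tgt_def by (intro pr_intros)

lemma edge_at: "e s \<noteq> 0 \<Longrightarrow> (src s, tgt s) \<in> E"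
  using enum by (simp add: edge_enum_def src_def tgt_def)

lemma edge_appears:
  assumes "(a, b) \<in> E"
  shows "\<exists>s\<ge>k. e s \<noteq> 0 \<and> src s = a \<and> tgt s = b"
proof -
  have "infinite {s. e s = Suc (prod_encode (a, b))}" using enum assms by (auto simp: edge_enum_def)
  then obtain s where "s \<ge> k" "e s = Suc (prod_encode (a, b))"
    unfolding infinite_nat_iff_unbounded_le by blast
  then show ?thesis by (auto simp: src_def tgt_def)
qed

text \<open>Parents are unique, so a single enumerated edge into a node decides every question about
  edges into it. This turns the enumeration of \<open>E\<close> into a decision procedure for edges
  into placed nodes.\<close>

lemma edge_to_tgt_iff: "e s \<noteq> 0 \<Longrightarrow> (a, tgt s) \<in> E \<longleftrightarrow> a = src s"
  using edge_at parent_unique by blast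

text \<open>Stages double as labels: a positive label goes to a tree node if its stage is the first
  positive candidate stage with that target. Stage 0 is reserved for the root, whatever it
  enumerates; an edge shown there recurs later.\<close>

definition placed :: "(nat \<Rightarrow> bool) \<Rightarrow> nat \<Rightarrow> bool" where
  "placed cand s \<longleftrightarrow> s = 0 \<or> cand s \<and> (\<forall>s'<s. s' = 0 \<or> \<not> cand s' \<or> tgt s' \<noteq> tgt s)"

definition node :: "nat \<Rightarrow> nat" where
  "node s = (if s = 0 then r else tgt s)"

lemma primrec_node [pr_intros]: "primrec_fun n a \<Longrightarrow> primrec_fun n (\<lambda>xs. node (a xs))"
  unfolding node_def by (intro pr_intros)

lemma primrec_placed:
  assumes "\<And>n a. primrec_fun n a \<Longrightarrow> primrec_fun n (\<lambda>xs. of_bool (cand (a xs)))" "primrec_fun n a"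
  shows "primrec_fun n (\<lambda>xs. of_bool (placed cand (a xs)))"
proof -
  have "primrec_fun 1 (\<lambda>xs. of_bool (placed cand (xs ! 0)))"
    unfolding placed_def by (intro assms(1) pr_intros) simp_all
  from primrec_fun_1[OF this assms(2)] show ?thesis .
qed

text \<open>Each target is taken exactly once, at its least positive candidate stage, and the root
  is no target, so label 0 clashes with nothing.\<close>

lemma bij_betw_node:
  assumes cand: "\<And>s. cand s \<Longrightarrow> e s \<noteq> 0"
  shows "bij_betw node {s. placed cand s} (insert r (tgt ` {s. 0 < s \<and> cand s}))"
  unfolding bij_betw_def
proof
  have nr: "tgt s \<noteq> r" if "cand s" for s
    using edge_at[OF cand[OF that]] root_no_parent by metis
  show "inj_on node {s. placed cand s}"
  proof (rule inj_onI)
    fix s t assume *: "s \<in> {s. placed cand s}" "t \<in> {s. placed cand s}" and eq: "node s = node t"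
    show "s = t"
    proof (cases "s = 0 \<or> t = 0")
      case True
      then show ?thesis using * eq nr by (auto simp: node_def placed_def split: if_splits)
    next
      case False
      then have "\<not> s < t" "\<not> t < s" using * eq by (auto simp: node_def placed_def)
      then show ?thesis by simp
    qed
  qed
  show "node ` {s. placed cand s} = insert r (tgt ` {s. 0 < s \<and> cand s})"
  proof
    show "node ` {s. placed cand s} \<subseteq> insert r (tgt ` {s. 0 < s \<and> cand s})"
      by (auto simp: node_def placed_def)
    have "r \<in> node ` {s. placed cand s}" by (rule image_eqI[of _ _ 0]) (auto simp: node_def placed_def)
    moreover have "tgt s \<in> node ` {s. placed cand s}" if s: "0 < s" "cand s" for s
    proof -
      let ?Q = "\<lambda>k. 0 < k \<and> cand k \<and> tgt k = tgt s"
      define t where "t = (LEAST k. ?Q k)"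
      have t: "?Q t" unfolding t_def by (rule LeastI[of ?Q s]) (use s in simp)
      have "\<not> ?Q k" if "k < t" for k using not_less_Least that unfolding t_def by blast
      with t have "placed cand t" unfolding placed_def by auto
      with t show ?thesis by (intro image_eqI[of _ _ t]) (auto simp: node_def)
    qed
    ultimately show "insert r (tgt ` {s. 0 < s \<and> cand s}) \<subseteq> node ` {s. placed cand s}" by auto
  qed
qed

text \<open>Silent stages place nothing, except that stage 0 places the root. This supplies the
  spare labels.\<close>

lemma infinite_not_placed:
  assumes cand: "\<And>s. cand s \<Longrightarrow> e s \<noteq> 0"
  shows "infinite {s. \<not> placed cand s}"
proof
  assume "finite {s. \<not> placed cand s}"
  moreover have "{s. e s = 0} \<subseteq> insert 0 {s. \<not> placed cand s}"
    by (auto simp: placed_def dest: cand)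
  ultimately have "finite {s. e s = 0}" by (meson finite.insertI finite_subset)
  then show False using enum by (simp add: edge_enum_def)
qed

section \<open>The case of infinitely many isolated elements\<close>

text \<open>The spare labels receive the isolated elements through an arbitrary bijection,
  computable or not: edges never involve them, so the edge test inspects placed labels only. The
  last conclusion serves the case in which some leaves are artificially isolated.\<close>

lemma labelling_if_infinitely_many_isolated:
  assumes "infinite (D - insert r (Range E))"
  shows "\<exists>h. bij_betw h UNIV D \<and> primrec_fun 2 (\<lambda>xs. of_bool ((h (xs ! 0), h (xs ! 1)) \<in> E)) \<and>
    primrec_fun 1 (\<lambda>xs. of_bool (h (xs ! 0) \<in> insert r (Range E)))"
proof -
  let ?pl = "placed (\<lambda>s. e s \<noteq> 0)"
  have img: "insert r (tgt ` {s. 0 < s \<and> e s \<noteq> 0}) = insert r (Range E)"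
  proof -
    have "b \<in> tgt ` {s. 0 < s \<and> e s \<noteq> 0}" if "(a, b) \<in> E" for a b
      using edge_appears[OF that, of 1] by force
    then show ?thesis using edge_at by blast
  qed
  have node: "bij_betw node {s. ?pl s} (insert r (Range E))"
    using bij_betw_node[of "\<lambda>s. e s \<noteq> 0"] unfolding img by blast
  have "infinite {s. \<not> ?pl s}" by (rule infinite_not_placed)
  then obtain g where g: "bij_betw g {s. \<not> ?pl s} (D - insert r (Range E))"
    using infinite_nat_sets_bij[OF _ assms] by blast
  define h where "h s = (if ?pl s then node s else g s)" for s
  have "bij_betw h {s. ?pl s} (insert r (Range E))"
    by (rule bij_betw_cong[THEN iffD1, OF _ node]) (simp add: h_def)
  moreover have "bij_betw h {s. \<not> ?pl s} (D - insert r (Range E))"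
    by (rule bij_betw_cong[THEN iffD1, OF _ g]) (simp add: h_def)
  ultimately have "bij_betw h ({s. ?pl s} \<union> {s. \<not> ?pl s})
      (insert r (Range E) \<union> (D - insert r (Range E)))"
    by (rule bij_betw_combine) auto
  moreover have "{s. ?pl s} \<union> {s. \<not> ?pl s} = UNIV" by auto
  moreover have "insert r (Range E) \<union> (D - insert r (Range E)) = D"
    using E_subset root_in by auto
  ultimately have bij: "bij_betw h UNIV D" by simp
  have hin: "h s \<in> insert r (Range E) \<longleftrightarrow> ?pl s" for s
    using node g by (auto simp: h_def bij_betw_def)
  have edge: "(h s', h s) \<in> E \<longleftrightarrow> ?pl s \<and> s \<noteq> 0 \<and> ?pl s' \<and> node s' = src s" for s s'
  proof (cases "?pl s \<and> s \<noteq> 0")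
    case True
    then have "h s = tgt s" "e s \<noteq> 0" by (auto simp: h_def node_def placed_def)
    then have "(h s', h s) \<in> E \<longleftrightarrow> h s' = src s" by (simp add: edge_to_tgt_iff)
    \<comment> \<open>The parent is a tree node, so a spare label cannot carry it.\<close>
    moreover have "src s \<in> insert r (Range E)" using edge_at[OF \<open>e s \<noteq> 0\<close>] Domain_E by blast
    ultimately show ?thesis using hin[of s'] True by (auto simp: h_def)
  next
    case False
    have "(h s', h s) \<notin> E"
    proof (cases "s = 0")
      case True
      then show ?thesis using root_no_parent by (simp add: h_def node_def placed_def)
    next
      case s: False
      then show ?thesis using hin[of s] False by auto
    qed
    then show ?thesis using False by blast
  qed
  have "primrec_fun 2 (\<lambda>xs. of_bool ((h (xs ! 0), h (xs ! 1)) \<in> E))"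
    unfolding edge by (intro primrec_placed pr_intros) simp_all
  moreover have "primrec_fun 1 (\<lambda>xs. of_bool (h (xs ! 0) \<in> insert r (Range E)))"
    unfolding hin by (intro primrec_placed pr_intros) simp_all
  ultimately show ?thesis using bij by blast
qed

section \<open>Records, for the case of infinitely many parents\<close>

text \<open>An upper bound on the root and on both ends of every record before the stage; the sum is
  a convenient bound on two ends. Starting at \<open>r\<close> keeps the root from being an end of a
  record.\<close>

definition record_bound :: "nat \<Rightarrow> nat" where
  "record_bound = rec_nat r (\<lambda>u m. if e u \<noteq> 0 \<and> m < src u \<and> m < tgt u then src u + tgt u else m)"

definition record_edge :: "nat \<Rightarrow> bool" where
  "record_edge u \<longleftrightarrow> e u \<noteq> 0 \<and> record_bound u < src u \<and> record_bound u < tgt u"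

lemma primrec_record_bound [pr_intros]:
  assumes "primrec_fun n a"
  shows "primrec_fun n (\<lambda>xs. record_bound (a xs))"
proof -
  have "primrec_fun 1 (\<lambda>xs. record_bound (xs ! 0))"
    unfolding record_bound_def by (intro pr_intros) simp_all
  from primrec_fun_1[OF this assms] show ?thesis .
qed

lemma primrec_record_edge [pr_intros]:
  "primrec_fun n a \<Longrightarrow> primrec_fun n (\<lambda>xs. of_bool (record_edge (a xs)))"
  unfolding record_edge_def by (intro pr_intros)

lemma record_bound_Suc:
  "record_bound (Suc u) = (if record_edge u then src u + tgt u else record_bound u)"
  by (simp add: record_bound_def record_edge_def)

lemma record_bound_mono: "u \<le> v \<Longrightarrow> record_bound u \<le> record_bound v"
  by (rule lift_Suc_mono_le[of record_bound]) (auto simp: record_bound_Suc record_edge_def)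

lemma root_le_record_bound: "r \<le> record_bound u"
  using record_bound_mono[of 0 u] by (simp add: record_bound_def)

lemma record_le_bound:
  assumes "record_edge u" "u < v"
  shows "src u \<le> record_bound v" "tgt u \<le> record_bound v"
  using record_bound_mono[of "Suc u" v] assms by (auto simp: record_bound_Suc)

text \<open>A record at stage \<open>v\<close> or later has both ends above
  \<open>record_bound v\<close>. Hence a record with an end within that bound is found by a search
  below \<open>v\<close>.\<close>

lemma record_before:
  assumes "record_edge u" "src u \<le> record_bound v \<or> tgt u \<le> record_bound v"
  shows "u < v"
  using assms record_bound_mono[of v u] by (force simp: record_edge_def not_less)

lemma record_edge_eqI:
  assumes "record_edge u" "record_edge v" "tgt u = tgt v \<or> src u = src v"
  shows "u = v"
proof -
  have "False" if "record_edge u" "record_edge v" "tgt u = tgt v \<or> src u = src v" "u < v" for u v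
    using record_le_bound[OF that(1,4)] that(2,3) by (auto simp: record_edge_def)
  from this[of u v] this[of v u] show ?thesis using assms by (cases u v rule: linorder_cases) auto
qed

text \<open>Of two records the later has both ends above all ends of the earlier, and no edge is a
  loop. So the parent of a record target is never itself a record target.\<close>

lemma record_src_neq_tgt:
  assumes "record_edge u" "record_edge v"
  shows "src u \<noteq> tgt v"
proof (cases u v rule: linorder_cases)
  case less
  then show ?thesis using record_le_bound(1)[OF assms(1) less] assms(2) by (auto simp: record_edge_def)
next
  case equal
  then show ?thesis using edge_at[of u] irrefl_E assms by (auto simp: record_edge_def)
next
  case greater
  then show ?thesis using record_le_bound(2)[OF assms(2) greater] assms(1) by (auto simp: record_edge_def)
qed

text \<open>If records stopped, the bound would be constant from some stage on. Infinitely many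
  parents exceed it, and children chosen for them are distinct because parents are unique, so one of
  these children exceeds it too. When that edge is enumerated again, it is a record.\<close>

lemma infinite_record_edges:
  assumes "infinite (Domain E)"
  shows "infinite {u. record_edge u}"
proof
  assume "finite {u. record_edge u}"
  then obtain k where k: "\<And>u. record_edge u \<Longrightarrow> u < k"
    by (metis finite_nat_set_iff_bounded mem_Collect_eq)
  have const: "record_bound u = record_bound k" if "u \<ge> k" for u
    using that by (induction u rule: dec_induct) (auto simp: record_bound_Suc dest: k)
  let ?A = "{a \<in> Domain E. record_bound k < a}"
  have "Domain E \<subseteq> {..record_bound k} \<union> ?A" by auto
  then have A: "infinite ?A" using assms finite_subset by blast
  obtain c where c: "\<And>a. a \<in> ?A \<Longrightarrow> (a, c a) \<in> E" using bchoice[of ?A "\<lambda>a b. (a, b) \<in> E"] by blast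
  have "inj_on c ?A" using c parent_unique by (intro inj_onI) metis
  then have "infinite (c ` ?A)" using A by (simp add: finite_image_iff)
  then obtain b where "b \<in> c ` ?A" "record_bound k < b"
    unfolding infinite_nat_iff_unbounded by blast
  then obtain a where a: "(a, b) \<in> E" "record_bound k < a" using c by blast
  obtain s where "s \<ge> k" "e s \<noteq> 0" "src s = a" "tgt s = b" using edge_appears[OF a(1)] by blast
  then have "record_edge s" using const[of s] a(2) \<open>record_bound k < b\<close> by (simp add: record_edge_def)
  then show False using k[of s] \<open>s \<ge> k\<close> by simp
qed

text \<open>Every record raises the bound by at least one, and there are infinitely many.\<close>

lemma record_bound_unbounded:
  assumes "infinite (Domain E)"
  shows "\<exists>k. \<forall>s\<ge>k. m \<le> record_bound s"
proof (induction m)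
  case (Suc m)
  then obtain k where k: "\<And>s. s \<ge> k \<Longrightarrow> m \<le> record_bound s" by blast
  obtain u where u: "u \<ge> k" "record_edge u"
    using infinite_record_edges[OF assms] unfolding infinite_nat_iff_unbounded_le by blast
  have "Suc m \<le> record_bound s" if "s \<ge> Suc u" for s
    using k[OF u(1)] u(2) record_le_bound(1)[OF u(2), of s] that by (simp add: record_edge_def)
  then show ?case by blast
qed simp

text \<open>
  An edge is acted upon only once the record bound has passed both ends: from then on it is
  decided whether they are record sources or record targets.
\<close>

definition settled :: "nat \<Rightarrow> bool" where
  "settled s \<longleftrightarrow> e s \<noteq> 0 \<and> src s \<le> record_bound s \<and> tgt s \<le> record_bound s \<and>
    (\<forall>u<s. \<not> record_edge u \<or> tgt u \<noteq> tgt s)"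

lemma primrec_settled [pr_intros]:
  assumes "primrec_fun n a"
  shows "primrec_fun n (\<lambda>xs. of_bool (settled (a xs)))"
proof -
  have "primrec_fun 1 (\<lambda>xs. of_bool (settled (xs ! 0)))"
    unfolding settled_def by (intro pr_intros) simp_all
  from primrec_fun_1[OF this assms] show ?thesis .
qed

text \<open>Records from stage \<open>s\<close> on have targets above the bound, so by looking at
  earlier records only, \<open>settled\<close> excludes all record targets. Conversely, the bound
  eventually passes both ends of any edge, and the edge is enumerated again after that.\<close>

lemma settled_targets:
  assumes "infinite (Domain E)"
  shows "tgt ` {s. 0 < s \<and> settled s} = Range E - tgt ` {u. record_edge u}"
proof
  show "tgt ` {s. 0 < s \<and> settled s} \<subseteq> Range E - tgt ` {u. record_edge u}"
    using edge_at record_before unfolding settled_def by fastforce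
  show "Range E - tgt ` {u. record_edge u} \<subseteq> tgt ` {s. 0 < s \<and> settled s}"
  proof
    fix b assume b: "b \<in> Range E - tgt ` {u. record_edge u}"
    then obtain a where a: "(a, b) \<in> E" by blast
    obtain k where k: "\<And>s. s \<ge> k \<Longrightarrow> a + b \<le> record_bound s"
      using record_bound_unbounded[OF assms] by blast
    obtain s where s: "s \<ge> Suc k" "e s \<noteq> 0" "src s = a" "tgt s = b"
      using edge_appears[OF a] by blast
    have "tgt u \<noteq> tgt s" if "record_edge u" for u
      using b s(4) that by (metis DiffD2 imageI mem_Collect_eq)
    moreover have "a + b \<le> record_bound s" using s(1) by (intro k) simp
    ultimately have "settled s" using s(2-4) unfolding settled_def by auto
    with s show "b \<in> tgt ` {s. 0 < s \<and> settled s}" by (intro image_eqI[of _ _ s]) auto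
  qed
qed

text \<open>Labels are split into the placed ones, a finite set \<open>F\<close> for the isolated
  elements, and the pool \<open>Q\<close>, whose n-th label carries the target of the n-th record.
  That record may come late, but every edge question about it reduces to a search bounded by the
  placed label at the other end.\<close>

lemma labelling_if_infinitely_many_parents:
  assumes inf: "infinite (Domain E)" and fin: "finite (D - insert r (Range E))"
  shows "\<exists>h. bij_betw h UNIV D \<and> primrec_fun 2 (\<lambda>xs. of_bool ((h (xs ! 0), h (xs ! 1)) \<in> E))"
proof -
  let ?pl = "placed settled"
  let ?I = "D - insert r (Range E)"
  let ?S = "tgt ` {u. record_edge u}"
  have e_settled: "e s \<noteq> 0" if "settled s" for s using that by (simp add: settled_def)
  have node: "bij_betw node {s. ?pl s} (insert r (Range E - ?S))"
    using bij_betw_node[of settled] e_settled settled_targets[OF inf] by simp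
  have np: "infinite {s. \<not> ?pl s}" using e_settled by (rule infinite_not_placed)
  obtain F where F: "finite F" "card F = card ?I" "F \<subseteq> {s. \<not> ?pl s}"
    using infinite_arbitrarily_large[OF np] by blast
  obtain g where g: "bij_betw g F ?I" using F fin finite_same_card_bij by blast
  define Q where "Q = {s. \<not> ?pl s \<and> s \<notin> F}"
  have "Q = {s. \<not> ?pl s} - F" by (auto simp: Q_def)
  then have Q: "infinite Q" using np F(1) by simp
  define rank_Q where "rank_Q = (\<lambda>s. card {k. k < s \<and> k \<in> Q})"
  define rank_R where "rank_R = (\<lambda>s. card {k. k < s \<and> record_edge k})"
  have bQ: "bij_betw rank_Q Q UNIV" using bij_betw_rank[OF Q] by (simp add: rank_Q_def)
  have bR: "bij_betw rank_R {u. record_edge u} UNIV"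
    using bij_betw_rank[OF infinite_record_edges[OF inf]] by (simp add: rank_R_def)
  \<comment> \<open>\<open>q s\<close> is the record whose target the pool label \<open>s\<close>
    carries. Only its graph, given by equality of ranks, enters the edge test.\<close>
  define q where "q = inv_into {u. record_edge u} rank_R \<circ> rank_Q"
  have q: "bij_betw q Q {u. record_edge u}"
    unfolding q_def by (rule bij_betw_trans[OF bQ bij_betw_inv_into[OF bR]])
  have rank_in: "rank_Q s \<in> rank_R ` {u. record_edge u}" for s using bR by (simp add: bij_betw_def)
  have qrec: "record_edge (q s)" for s using inv_into_into[OF rank_in] by (simp add: q_def)
  have rank_q: "rank_R (q s) = rank_Q s" for s using f_inv_into_f[OF rank_in] by (simp add: q_def)
  have q_iff: "record_edge u \<and> rank_R u = rank_Q s \<longleftrightarrow> u = q s" for u s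
    using qrec rank_q inj_onD[OF bij_betw_imp_inj_on[OF bR], of u "q s"] by auto
  have "bij_betw tgt {u. record_edge u} ?S"
    by (rule inj_on_imp_bij_betw) (auto intro!: inj_onI record_edge_eqI)
  then have tq: "bij_betw (\<lambda>s. tgt (q s)) Q ?S" using bij_betw_trans[OF q] by (simp add: comp_def)
  define h where "h s = (if ?pl s then node s else if s \<in> F then g s else tgt (q s))" for s
  have S: "?S \<subseteq> Range E" using edge_at by (auto simp: record_edge_def)
  have rS: "r \<notin> Range E" using root_no_parent by blast
  have "bij_betw h {s. ?pl s} (insert r (Range E - ?S))"
    by (rule bij_betw_cong[THEN iffD1, OF _ node]) (simp add: h_def)
  moreover have "bij_betw h F ?I"
    by (rule bij_betw_cong[THEN iffD1, OF _ g]) (use F in \<open>auto simp: h_def\<close>)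
  ultimately have "bij_betw h ({s. ?pl s} \<union> F) (insert r (Range E - ?S) \<union> ?I)"
    by (rule bij_betw_combine) auto
  moreover have "bij_betw h Q ?S"
    by (rule bij_betw_cong[THEN iffD1, OF _ tq]) (auto simp: h_def Q_def)
  ultimately have "bij_betw h ({s. ?pl s} \<union> F \<union> Q) (insert r (Range E - ?S) \<union> ?I \<union> ?S)"
    by (rule bij_betw_combine) (use S rS in auto)
  moreover have "{s. ?pl s} \<union> F \<union> Q = UNIV" by (auto simp: Q_def)
  moreover have "insert r (Range E - ?S) \<union> ?I \<union> ?S = D"
    using E_subset root_in S by auto
  ultimately have bij: "bij_betw h UNIV D" by simp

  have hF: "h s \<in> ?I" if "s \<in> F" for s using that g F(3) by (auto simp: h_def bij_betw_def)
  have hQ: "h s = tgt (q s)" if "s \<in> Q" for s using that by (auto simp: h_def Q_def)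
  have hP: "h s = node s" if "?pl s" for s using that by (simp add: h_def)
  have cases: "?pl s \<or> s \<in> F \<or> s \<in> Q" for s by (auto simp: Q_def)
  have QP: "\<not> ?pl s" "s \<notin> F" if "s \<in> Q" for s using that by (auto simp: Q_def)
  have FP: "\<not> ?pl s" "s \<notin> Q" if "s \<in> F" for s using that F by (auto simp: Q_def)

  \<comment> \<open>The clauses are: both ends placed, parent in the pool, child in the pool. Two
    pool labels are never joined, as a record source is not a record target.\<close>
  have edge: "(h s', h s) \<in> E \<longleftrightarrow>
      ?pl s \<and> s \<noteq> 0 \<and> ?pl s' \<and> node s' = src s \<or>
      ?pl s \<and> s \<noteq> 0 \<and> s' \<in> Q \<and> (\<exists>u<s. record_edge u \<and> rank_R u = rank_Q s' \<and> tgt u = src s) \<or>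
      s \<in> Q \<and> ?pl s' \<and> (\<exists>u<s'. record_edge u \<and> rank_R u = rank_Q s \<and> src u = node s')"
    (is "_ \<longleftrightarrow> ?rhs") for s s'
  proof -
    have source: "x \<notin> ?I" if "(x, y) \<in> E" for x y using that Domain_E by blast
    consider (root) "s = 0" | (placed) "?pl s" "s \<noteq> 0" | (isolated) "s \<in> F" | (pool) "s \<in> Q"
      using cases by blast
    then show ?thesis
    proof cases
      case root
      then have "?pl s" "h s = r" by (simp_all add: h_def placed_def node_def)
      then show ?thesis using root_no_parent root QP by metis
    next
      case placed
      then have st: "settled s" "h s = tgt s" by (auto simp: placed_def h_def node_def)
      then have E: "(h s', h s) \<in> E \<longleftrightarrow> h s' = src s" using e_settled edge_to_tgt_iff by metis
      consider "?pl s'" | "s' \<in> F" | "s' \<in> Q" using cases by blast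
      then show ?thesis
      proof cases
        case 1
        then show ?thesis using placed E hP QP by metis
      next
        case 2
        then have "h s' \<noteq> src s" using hF source edge_at e_settled st(1) by metis
        then show ?thesis using 2 E FP QP placed by metis
      next
        case 3
        \<comment> \<open>Stage \<open>s\<close> is settled, so the parent \<open>src s\<close> lies
          within the bound, and a record with that target precedes \<open>s\<close>.\<close>
        have "tgt (q s') = src s \<Longrightarrow> q s' < s"
          using record_before[OF qrec[of s']] st(1) by (simp add: settled_def)
        then have "(\<exists>u<s. record_edge u \<and> rank_R u = rank_Q s' \<and> tgt u = src s) \<longleftrightarrow> tgt (q s') = src s"
          using q_iff[of _ s'] by metis
        then show ?thesis using 3 E QP placed hQ by metis
      qed
    next
      case isolated
      then have "(h s', h s) \<notin> E" using hF[of s] by blast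
      then show ?thesis using FP[OF isolated] by blast
    next
      case pool
      let ?u = "q s"
      have u: "record_edge ?u" "e ?u \<noteq> 0" using qrec[of s] by (auto simp: record_edge_def)
      have E: "(h s', h s) \<in> E \<longleftrightarrow> h s' = src ?u" using hQ[OF pool] edge_to_tgt_iff[OF u(2)] by simp
      consider "?pl s'" | "s' \<in> F" | "s' \<in> Q" using cases by blast
      then show ?thesis
      proof cases
        case 1
        \<comment> \<open>A placed node other than the root lies within the bound of its stage, so
          the record comes earlier. The root is no record source, since no record bound is below
          it.\<close>
        have "?u < s'" if "src ?u = node s'"
        proof (cases "s' = 0")
          case True
          then have "src ?u = r" using that by (simp add: node_def)
          then show ?thesis using u(1) root_le_record_bound[of ?u] by (simp add: record_edge_def)
        next
          case False
          then have "settled s'" "node s' = tgt s'" using 1 by (auto simp: placed_def node_def)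
          then show ?thesis using record_before[OF u(1)] that by (simp add: settled_def)
        qed
        then have "(\<exists>u<s'. record_edge u \<and> rank_R u = rank_Q s \<and> src u = node s') \<longleftrightarrow> src ?u = node s'"
          using q_iff[of _ s] by metis
        then show ?thesis using 1 E QP pool hP by metis
      next
        case 2
        then have "h s' \<noteq> src ?u" using hF source edge_at u(2) by metis
        then show ?thesis using 2 E FP QP pool by metis
      next
        case 3
        then have "h s' \<noteq> src ?u" using hQ[OF 3] record_src_neq_tgt[OF u(1) qrec[of s']] by metis
        then show ?thesis using 3 E QP pool by metis
      qed
    qed
  qed
  have pp: "primrec_fun n (\<lambda>xs. of_bool (?pl (a xs)))" if "primrec_fun n a" for n a
    using primrec_settled that by (rule primrec_placed)
  have pQ: "primrec_fun n (\<lambda>xs. of_bool (a xs \<in> Q))" if "primrec_fun n a" for n a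
    unfolding Q_def mem_Collect_eq by (intro pp pr_intros that F(1))
  have pRQ: "primrec_fun n (\<lambda>xs. rank_Q (a xs))" "primrec_fun n (\<lambda>xs. rank_R (a xs))"
    if "primrec_fun n a" for n a
    unfolding rank_Q_def rank_R_def by (intro pQ pr_intros that; simp)+
  have "primrec_fun 2 (\<lambda>xs. of_bool ((h (xs ! 0), h (xs ! 1)) \<in> E))"
    unfolding edge by (intro pp pQ pRQ pr_intros) simp_all
  then show ?thesis using bij by blast
qed

section \<open>The case of finitely many parents\<close>

text \<open>Infinitely many children of finitely many parents give a node \<open>v\<close> with
  infinitely many children, almost all of them leaves. Dropping the edges from \<open>v\<close> to
  leaves isolates these, so the case of infinitely many isolated elements applies; the dropped edges
  are restored using the label of \<open>v\<close>.\<close>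

lemma labelling_if_finitely_many_parents:
  assumes D: "infinite D" and fin: "finite (Domain E)" "finite (D - insert r (Range E))"
  shows "\<exists>h. bij_betw h UNIV D \<and> primrec_fun 2 (\<lambda>xs. of_bool ((h (xs ! 0), h (xs ! 1)) \<in> E))"
proof -
  have "infinite (Range E)"
  proof
    assume "finite (Range E)"
    then have "finite ((D - insert r (Range E)) \<union> insert r (Range E))" using fin(2) by blast
    then show False using D by (rule_tac notE) (auto elim: finite_subset[rotated])
  qed
  moreover have "Range E = (\<Union>v\<in>Domain E. E `` {v})" by blast
  ultimately obtain v where v: "infinite (E `` {v})" using fin(1) by auto
  define E' where "E' = {(a, b) \<in> E. a \<noteq> v \<or> b \<in> Domain E}"
  \<comment> \<open>\<open>Domain E\<close> is finite and thus hard-wired, so this filter is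
    primitive recursive.\<close>
  define e' where "e' s = (if src s \<noteq> v \<or> tgt s \<in> Domain E then e s else 0)" for s
  have "edge_enum e' E'"
    unfolding edge_enum_def
  proof (intro conjI allI impI ballI)
    show "primrec_fun 1 (\<lambda>xs. e' (xs ! 0))"
      unfolding e'_def by (intro pr_intros fin(1)) simp_all
    show "prod_decode (e' s - 1) \<in> E'" if "e' s \<noteq> 0" for s
      using that edge_at[of s] unfolding e'_def E'_def
      by (cases "prod_decode (e s - 1)") (auto simp: src_def tgt_def split: if_splits)
    show "infinite {s. e' s = Suc (prod_encode p)}" if p: "p \<in> E'" for p
    proof -
      have "p \<in> E" using p by (auto simp: E'_def)
      then have "infinite {s. e s = Suc (prod_encode p)}" using enum by (simp add: edge_enum_def)
      moreover have "{s. e s = Suc (prod_encode p)} \<subseteq> {s. e' s = Suc (prod_encode p)}"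
        using p by (auto simp: e'_def E'_def src_def tgt_def)
      ultimately show ?thesis using finite_subset by blast
    qed
    have "{s. e s = 0} \<subseteq> {s. e' s = 0}" by (auto simp: e'_def)
    then show "infinite {s. e' s = 0}" using enum finite_subset unfolding edge_enum_def by blast
  qed
  moreover have "E' \<subseteq> E" by (auto simp: E'_def)
  moreover have "Domain E' \<subseteq> insert r (Range E')"
  proof
    fix a assume "a \<in> Domain E'"
    then have a: "a \<in> Domain E" by (auto simp: E'_def)
    then have "a = r \<or> a \<in> Range E" using Domain_E by blast
    then show "a \<in> insert r (Range E')" using a unfolding E'_def by blast
  qed
  ultimately interpret F: enumerated_forest D r E' e'
    using E_subset root_in root_no_parent irrefl_E parent_unique
    by unfold_locales blast+
  have leaf: "(v, b) \<in> E \<and> b \<notin> Domain E \<longleftrightarrow> b \<in> Range E \<and> b \<notin> insert r (Range E')" for b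
  proof
    assume b: "(v, b) \<in> E \<and> b \<notin> Domain E"
    have "(a, b) \<notin> E'" for a
    proof
      assume *: "(a, b) \<in> E'"
      then have "a = v" using b parent_unique \<open>E' \<subseteq> E\<close> by blast
      then show False using * b by (auto simp: E'_def)
    qed
    moreover have "b \<noteq> r" using b root_no_parent by blast
    ultimately show "b \<in> Range E \<and> b \<notin> insert r (Range E')" using b by blast
  next
    assume "b \<in> Range E \<and> b \<notin> insert r (Range E')"
    then show "(v, b) \<in> E \<and> b \<notin> Domain E" unfolding E'_def by blast
  qed
  have "E `` {v} \<subseteq> (D - insert r (Range E')) \<union> Domain E"
    using leaf E_subset by blast
  then have "infinite (D - insert r (Range E'))"
    using v fin(1) by (meson finite_UnI finite_subset)
  from F.labelling_if_infinitely_many_isolated[OF this]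
  obtain h where h: "bij_betw h UNIV D"
      and pE: "primrec_fun 2 (\<lambda>xs. of_bool ((h (xs ! 0), h (xs ! 1)) \<in> E'))"
      and pI: "primrec_fun 1 (\<lambda>xs. of_bool (h (xs ! 0) \<in> insert r (Range E')))"
    by blast
  have inj: "inj h" and hD: "h s \<in> D" for s using h by (auto simp: bij_betw_def)
  \<comment> \<open>The finitely many labels of elements isolated from the start. Outside the
    reduced tree, all other labels carry leaf children of \<open>v\<close>.\<close>
  define I where "I = h -` (D - insert r (Range E))"
  have I: "finite I" unfolding I_def using fin(2) inj by (rule finite_vimageI)
  obtain w where w: "h w = v"
  proof -
    have "v \<in> D" using v E_subset by (metis Image_singleton_iff SigmaD1 all_not_in_conv finite.emptyI subsetD)
    then show thesis using that h by (metis bij_betw_imp_surj_on imageE)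
  qed
  have edge: "(h s', h s) \<in> E \<longleftrightarrow>
      (h s', h s) \<in> E' \<or> s' = w \<and> h s \<notin> insert r (Range E') \<and> s \<notin> I" for s s'
  proof -
    have "(h s', h s) \<in> E \<longleftrightarrow> (h s', h s) \<in> E' \<or> h s' = v \<and> (v, h s) \<in> E \<and> h s \<notin> Domain E"
      by (auto simp: E'_def)
    moreover have "h s' = v \<longleftrightarrow> s' = w" using w inj by (metis injD)
    moreover have "h s \<notin> insert r (Range E') \<Longrightarrow> s \<notin> I \<longleftrightarrow> h s \<in> Range E"
      using hD[of s] by (auto simp: I_def)
    ultimately show ?thesis using leaf by blast
  qed
  have "primrec_fun 2 (\<lambda>xs. of_bool ((h (xs ! 0), h (xs ! 1)) \<in> E))"
    unfolding edge by (intro pE primrec_fun_1[OF pI] pr_intros I) simp_all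
  then show ?thesis using h by blast
qed

lemma labelling_exists:
  assumes "infinite D"
  shows "\<exists>h. bij_betw h UNIV D \<and> primrec_fun 2 (\<lambda>xs. of_bool ((h (xs ! 0), h (xs ! 1)) \<in> E))"
  using assms labelling_if_infinitely_many_isolated labelling_if_infinitely_many_parents
    labelling_if_finitely_many_parents
  by blast

end

subsection \<open>Punctual copies\<close>

text \<open>Injectivity makes a node the end of at most one tuple, whence parents are unique, the
  root has none and there are no loops. The last fact shows that the root and the edges determine
  all relations; the others are what a forest requires.\<close>

lemma injective_prefix_tree_edges:
  assumes "injective_prefix_tree T"
  shows "tree_edges T \<subseteq> universe T \<times> universe T"
    and "(a, distinguished T) \<notin> tree_edges T"
    and "Domain (tree_edges T) \<subseteq> insert (distinguished T) (Range (tree_edges T))"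
    and "(a, a) \<notin> tree_edges T"
    and "(a, c) \<in> tree_edges T \<Longrightarrow> (b, c) \<in> tree_edges T \<Longrightarrow> a = b"
    and "xs \<in> relation T n \<longleftrightarrow> length xs = Suc n \<and> xs ! 0 = distinguished T \<and>
      (\<forall>k<n. (xs ! k, xs ! Suc k) \<in> tree_edges T)"
proof -
  let ?r = "distinguished T"
  let ?E = "tree_edges T"
  have "wf_structure T" "arity T = Suc"
    using assms by (simp_all add: injective_prefix_tree_def prefix_tree_def)
  then have "relation T n \<subseteq> {xs \<in> lists (universe T). length xs = Suc n}" for n
    unfolding wf_structure_def by metis
  then have len: "length xs = Suc n" and univ: "set xs \<subseteq> universe T" if "xs \<in> relation T n" for xs n
    using that by blast+
  have root: "relation T 0 = {[?r]}"
    and pre: "\<And>n as i. as \<in> relation T n \<Longrightarrow> i \<le> n \<Longrightarrow> take (Suc i) as \<in> relation T i"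
    using assms unfolding injective_prefix_tree_def prefix_tree_def by blast+
  have inj: "n = k \<and> as = bs" if "as @ [c] \<in> relation T n" "bs @ [c] \<in> relation T k" for n k as bs c
    using assms that unfolding injective_prefix_tree_def by blast
  have dest: "xs @ [a] \<in> relation T (length xs) \<and> n = Suc (length xs)"
    if "xs @ [a, b] \<in> relation T n" for xs a b n
  proof -
    have n: "n = Suc (length xs)" using len[OF that] by simp
    then show ?thesis using pre[OF that, of "length xs"] by simp
  qed
  show "?E \<subseteq> universe T \<times> universe T"
  proof (clarsimp simp: tree_edges_def)
    fix a b n xs assume "xs @ [a, b] \<in> relation T n"
    from univ[OF this] show "a \<in> universe T \<and> b \<in> universe T" by simp
  qed
  show "(a, ?r) \<notin> ?E"
  proof
    assume "(a, ?r) \<in> ?E"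
    then obtain n xs where "(xs @ [a]) @ [?r] \<in> relation T n" by (auto simp: tree_edges_def)
    moreover have "[] @ [?r] \<in> relation T 0" by (simp add: root)
    ultimately have "xs @ [a] = []" using inj by blast
    then show False by simp
  qed
  show "Domain ?E \<subseteq> insert ?r (Range ?E)"
  proof
    fix a assume "a \<in> Domain ?E"
    then obtain n xs b where "xs @ [a, b] \<in> relation T n" by (auto simp: tree_edges_def)
    from dest[OF this] have a: "xs @ [a] \<in> relation T (length xs)" by simp
    show "a \<in> insert ?r (Range ?E)"
    proof (cases xs rule: rev_cases)
      case Nil
      then show ?thesis using a by (simp add: root)
    next
      case (snoc ys y)
      then have "ys @ [y, a] \<in> relation T (length xs)" using a by simp
      then have "(y, a) \<in> ?E" unfolding tree_edges_def by blast
      then show ?thesis by blast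
    qed
  qed
  show "(a, a) \<notin> ?E"
  proof
    assume "(a, a) \<in> ?E"
    then obtain n xs where xs: "xs @ [a, a] \<in> relation T n" by (auto simp: tree_edges_def)
    then have "(xs @ [a]) @ [a] \<in> relation T n" by simp
    then have "xs = xs @ [a]" using inj dest[OF xs] by blast
    then show False by simp
  qed
  show "a = b" if parents: "(a, c) \<in> ?E" "(b, c) \<in> ?E"
  proof -
    obtain n k xs ys where "(xs @ [a]) @ [c] \<in> relation T n" "(ys @ [b]) @ [c] \<in> relation T k"
      using parents by (auto simp: tree_edges_def)
    from inj[OF this] show ?thesis by simp
  qed
  show "xs \<in> relation T n \<longleftrightarrow> length xs = Suc n \<and> xs ! 0 = ?r \<and>
      (\<forall>k<n. (xs ! k, xs ! Suc k) \<in> ?E)"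
  proof
    assume xs: "xs \<in> relation T n"
    have l: "length xs = Suc n" by (rule len[OF xs])
    have "take (Suc 0) xs \<in> relation T 0" using pre[OF xs] by blast
    then have "xs ! 0 = ?r" using l by (cases xs) (auto simp: root)
    moreover have "(xs ! k, xs ! Suc k) \<in> ?E" if "k < n" for k
    proof -
      have "take (Suc (Suc k)) xs = take k xs @ [xs ! k, xs ! Suc k]"
        using that l by (simp add: take_Suc_conv_app_nth)
      moreover have "take (Suc (Suc k)) xs \<in> relation T (Suc k)" using pre[OF xs] that by simp
      ultimately show ?thesis unfolding tree_edges_def by auto
    qed
    ultimately show "length xs = Suc n \<and> xs ! 0 = ?r \<and> (\<forall>k<n. (xs ! k, xs ! Suc k) \<in> ?E)"
      using l by blast
  next
    assume "length xs = Suc n \<and> xs ! 0 = ?r \<and> (\<forall>k<n. (xs ! k, xs ! Suc k) \<in> ?E)"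
    then show "xs \<in> relation T n"
    proof (induction n arbitrary: xs)
      case 0
      then show ?case by (auto simp: root length_Suc_conv)
    next
      case (Suc n)
      let ?ys = "take n xs" and ?b = "xs ! n" and ?c = "xs ! Suc n"
      have l: "length xs = Suc (Suc n)" using Suc.prems by blast
      have t: "take (Suc n) xs = ?ys @ [?b]" "xs = ?ys @ [?b, ?c]"
        using l take_Suc_conv_app_nth[of "Suc n" xs] by (simp_all add: take_Suc_conv_app_nth)
      have "take (Suc n) xs \<in> relation T n"
        by (rule Suc.IH) (use Suc.prems in auto)
      then have b: "?ys @ [?b] \<in> relation T n" by (simp only: t(1))
      have "(?b, ?c) \<in> ?E" using Suc.prems by blast
      then obtain m ws where ws: "ws @ [?b, ?c] \<in> relation T m" by (auto simp: tree_edges_def)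
      \<comment> \<open>The edge is witnessed at the end of some tuple; the part of that tuple up to
        \<open>?b\<close> and the given path to \<open>?b\<close> agree by injectivity.\<close>
      have w: "length ws = n \<and> ws = ?ys"
        by (rule inj[OF _ b]) (use dest[OF ws] in blast)
      then have m: "m = Suc n" using dest[OF ws] by metis
      have "ws = ?ys" using w by blast
      then have "xs = ws @ [?b, ?c]" using t(2) by metis
      then have "xs \<in> relation T m" by (subst \<open>xs = ws @ [?b, ?c]\<close>) (rule ws)
      then show ?case by (simp only: m)
    qed
  qed
qed

section \<open>Assembling the punctual copy\<close>

text \<open>On codes, the length and the entries are expressed by \<open>drop_code\<close> and
  \<open>nth_code\<close>, which leaves only quantifiers bounded in terms of the index.\<close>

lemma primrec_fun_paths:
  assumes "primrec_fun 2 (\<lambda>xs. of_bool (P (xs ! 0) (xs ! 1)))"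
  shows "primrec_fun 2 (\<lambda>xs. of_bool (length (list_decode (xs ! 1)) = Suc (xs ! 0) \<and>
    list_decode (xs ! 1) ! 0 = r \<and>
    (\<forall>k<xs ! 0. P (list_decode (xs ! 1) ! k) (list_decode (xs ! 1) ! Suc k))))"
proof -
  have eq: "length xs = Suc n \<and> xs ! 0 = r \<and> (\<forall>k<n. P (xs ! k) (xs ! Suc k)) \<longleftrightarrow>
    (\<forall>k<Suc n. drop_code k (list_encode xs) \<noteq> 0) \<and> drop_code (Suc n) (list_encode xs) = 0 \<and>
    nth_code 0 (list_encode xs) = r \<and>
    (\<forall>k<n. P (nth_code k (list_encode xs)) (nth_code (Suc k) (list_encode xs)))" for xs n
    using length_list_code_iff[of xs "Suc n"] by (auto simp: nth_code_list_encode)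
  show ?thesis
    unfolding eq list_decode_inverse
    by (intro primrec_fun_2[OF assms] pr_intros) simp_all
qed

text \<open>The relations are pulled back along the labelling \<open>h\<close>. Since they consist
  of paths, they are primitive recursive uniformly in the index as soon as the pulled-back edge
  relation is.\<close>

lemma punctual_copy:
  assumes T: "injective_prefix_tree T" and inf: "infinite (universe T)" and comp: "computable_structure T"
  shows "\<exists>P. injective_prefix_tree P \<and> punctual P \<and> T \<simeq> P"
proof -
  let ?r = "distinguished T"
  note edges = injective_prefix_tree_edges[OF T]
  have "\<exists>e. edge_enum e (tree_edges T)"
    by (rule edge_enum_tree_edges) (use comp edges(6) in \<open>auto simp: computable_structure_def\<close>)
  then obtain e where e: "edge_enum e (tree_edges T)" by blast
  have r: "?r \<in> universe T"
    using comp by (simp add: computable_structure_def wf_structure_def)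
  interpret enumerated_forest "universe T" ?r "tree_edges T" e
    using edges(1-5) r e by unfold_locales
  obtain h where h: "bij_betw h UNIV (universe T)"
      and pE: "primrec_fun 2 (\<lambda>xs. of_bool ((h (xs ! 0), h (xs ! 1)) \<in> tree_edges T))"
    using labelling_exists[OF inf] by blast
  have inj: "inj h" using h by (simp add: bij_betw_def)
  obtain r' where r': "h r' = ?r" using h r by (metis bij_betw_imp_surj_on imageE)
  have hr: "h x = ?r \<longleftrightarrow> x = r'" for x using r' inj by (metis injD)
  define P where "P = \<lparr>universe = UNIV, arity = Suc,
    relation = (\<lambda>n. {xs. map h xs \<in> relation T n}), distinguished = r'\<rparr>"
  have sel: "universe P = UNIV" "arity P = Suc" "distinguished P = r'"
    "xs \<in> relation P n \<longleftrightarrow> map h xs \<in> relation T n" for xs n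
    by (simp_all add: P_def)
  have paths: "xs \<in> relation P n \<longleftrightarrow> length xs = Suc n \<and> xs ! 0 = r' \<and>
      (\<forall>k<n. (h (xs ! k), h (xs ! Suc k)) \<in> tree_edges T)" for xs n
    unfolding sel edges(6)[of "map h xs"] by (auto simp: hr)
  have wf: "wf_structure P" unfolding wf_structure_def sel using paths by auto
  have iT: "take (Suc i) as \<in> relation T i" if "as \<in> relation T n" "i \<le> n" for as i n
    using T that unfolding injective_prefix_tree_def prefix_tree_def by blast
  have "prefix_tree P"
    unfolding prefix_tree_def
  proof (intro conjI wf sel(2) allI ballI impI)
    show "relation P 0 = {[distinguished P]}"
      by (auto simp: paths sel(3) length_Suc_conv)
    show "take (Suc i) as \<in> relation P i" if "as \<in> relation P n" "i \<le> n" for as i n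
      using that iT[of "map h as" n i] by (simp add: sel(4) take_map)
  qed
  moreover have "n = k \<and> as = bs" if "as @ [c] \<in> relation P n" "bs @ [c] \<in> relation P k" for n k as bs c
  proof -
    have "map h as @ [h c] \<in> relation T n" "map h bs @ [h c] \<in> relation T k" using that by (simp_all add: sel(4))
    then have "n = k \<and> map h as = map h bs" using T unfolding injective_prefix_tree_def by blast
    then show ?thesis using inj by (simp add: inj_map_eq_map)
  qed
  ultimately have "injective_prefix_tree P" unfolding injective_prefix_tree_def by blast
  moreover have "punctual P"
    unfolding punctual_def
  proof (intro conjI wf sel(1))
    show "primrec_fun 2 (relations_char P)"
      unfolding relations_char_def paths by (rule primrec_fun_paths[OF pE])
    show "primrec_fun 0 (\<lambda>_. distinguished P)" by (rule primrec_fun_const)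
    show "primrec_fun 1 (\<lambda>xs. arity P (xs ! 0))" unfolding sel by (intro pr_intros) simp
  qed
  moreover have "T \<simeq> P"
    unfolding isomorphic_def
  \<comment> \<open>\<open>h\<close> runs from labels to the universe, so the isomorphism is its
    inverse.\<close>
  proof (intro conjI exI[of _ "inv_into UNIV h"] allI ballI impI)
    show "arity T = arity P"
      using T by (simp add: sel injective_prefix_tree_def prefix_tree_def)
    show "bij_betw (inv_into UNIV h) (universe T) (universe P)"
      using bij_betw_inv_into[OF h] by (simp add: sel)
    show "inv_into UNIV h ?r = distinguished P"
      using inj by (simp add: sel r'[symmetric])
    fix i xs assume "xs \<in> lists (universe T)"
    then have "map h (map (inv_into UNIV h) xs) = xs"
      using h by (auto simp: bij_betw_def f_inv_into_f intro!: map_idI)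
    then show "xs \<in> relation T i \<longleftrightarrow> map (inv_into UNIV h) xs \<in> relation P i"
      by (simp only: sel(4))
  qed
  ultimately show ?thesis by blast
qed

theorem theorem31:
  shows "punctually_robust injective_prefix_trees \<and>
    (\<forall>T \<in> injective_prefix_trees. computable_structure T \<longrightarrow>
      (\<exists>P. injective_prefix_tree P \<and> punctual P \<and> T \<simeq> P))"
  using punctual_copy unfolding punctually_robust_def injective_prefix_trees_def by blast

end
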